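(* Let $p$ be a prime with $p\equiv 1\pmod 4$. Then for every $\ell\in\mathbb{N}$ the number $\mathcal{K}_4(\Gamma(2,p^{\ell}))$ is determined by $\mathcal{K}_4(\Gamma(2,p))$, and $$\mathcal{K}_4(\Gamma(2,p^{\ell}))=\frac{p^{\ell}(p^{\ell}-1)\big((p^{\ell}-9)^2-16f_{\ell}^2\big)}{2^9\cdot 3},$$ where $f_{\ell}=-\tfrac{i}{4}(e_1+2f_1 i)^{\ell}+\tfrac{i}{4}(e_1-2f_1 i)^{\ell}=\tfrac12\,\mathrm{Im}\,(e_1+2f_1 i)^{\ell}$, with $e_1,f_1\in\mathbb{Z}$ a solution of $p=X^2+4Y^2$ satisfying $e_1\equiv 1\pmod 4$ and $(e_1,p)=1$.
   Context: The Paley graph $\Gamma(2,q)$ is the Cayley graph $\mathrm{Cay}(\mathbb{F}_q,\{x^2: x\in\mathbb{F}_q^*\})$: vertex set $\mathbb{F}_q$, with $v,w$ adjacent iff $w-v$ is a nonzero square. For a graph $H$, $\mathcal{K}_{4}(H)$ denotes the number of cliques of $H$ with exactly $4$ vertices. *)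

theory Defs
  imports Complex_Main "HOL-Library.Cardinality" "HOL-Number_Theory.Number_Theory"
begin

definition cayley_edges :: "'a::group_add set \<Rightarrow> ('a \<times> 'a) set" where
  "cayley_edges S = {(v, w). w - v \<in> S}"

text \<open>The vertex set of the Paley graph is the whole field, i.e. \<open>UNIV\<close>.\<close>

definition paley_edges :: "('a::field \<times> 'a) set" where
  "paley_edges = cayley_edges {x\<^sup>2 | x. x \<noteq> 0}"

definition clique :: "'v set \<Rightarrow> ('v \<times> 'v) set \<Rightarrow> 'v set \<Rightarrow> bool" where
  "clique V E C \<longleftrightarrow> C \<subseteq> V \<and> (\<forall>v\<in>C. \<forall>w\<in>C. v \<noteq> w \<longrightarrow> (v, w) \<in> E)"

definition num_cliques :: "nat \<Rightarrow> 'v set \<Rightarrow> ('v \<times> 'v) set \<Rightarrow> nat" where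
  "num_cliques n V E = card {C. clique V E C \<and> finite C \<and> card C = n}"

text \<open>The type argument is the finite field over which the Paley graph is taken.\<close>

definition paley_K4 :: "'a::{field,finite} itself \<Rightarrow> nat" where
  "paley_K4 _ = num_cliques 4 (UNIV :: 'a set) paley_edges"

definition f_seq :: "real \<Rightarrow> real \<Rightarrow> nat \<Rightarrow> complex" where
  "f_seq e f l = - (\<i> / 4) * (of_real e + 2 * of_real f * \<i>) ^ l
                 + (\<i> / 4) * (of_real e - 2 * of_real f * \<i>) ^ l"

definition K4_formula :: "nat \<Rightarrow> nat \<Rightarrow> real \<Rightarrow> real \<Rightarrow> complex" where
  "K4_formula p l e f =
     of_nat p ^ l * (of_nat p ^ l - 1) * ((of_nat p ^ l - 9)\<^sup>2 - 16 * (f_seq e f l)\<^sup>2) / (2 ^ 9 * 3)"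

text \<open>
  How the number \<open>k\<close> of 4-cliques over the field with \<open>p\<close> elements determines the number over
  its extension of degree \<open>l\<close>: solve \<open>k = p (p - 1) ((p - 9)\<^sup>2 - 16 f\<^sup>2) / (2 ^ 9 * 3)\<close> for
  \<open>f \<ge> 0\<close>, then \<open>p = e\<^sup>2 + 4 f\<^sup>2\<close> for \<open>e \<ge> 0\<close>, and insert \<open>e\<close>, \<open>f\<close> into the formula.
  An explicit function of \<open>p\<close>, \<open>l\<close>, \<open>k\<close> is used because, with \<open>p\<close> and \<open>l\<close> fixed, the mere
  existence of such a function says nothing. The signs of \<open>e\<close> and \<open>f\<close> do not affect
  \<open>(f_seq e f l)\<^sup>2\<close>.
\<close>

definition K4_from_prime_field :: "nat \<Rightarrow> nat \<Rightarrow> nat \<Rightarrow> complex" where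
  "K4_from_prime_field p l k =
     (let f = sqrt (((real p - 9)\<^sup>2 - 2 ^ 9 * 3 * real k / (real p * (real p - 1))) / 16);
          e = sqrt (real p - 4 * f\<^sup>2)
      in K4_formula p l e f)"

end

(*
  Translations and multiplications by squares are automorphisms of the Paley graph, so K4 is
  counted by the edges between common neighbours of 0 and 1. Expanding with the quadratic
  character chi reduces this count to the sum D of chi(x(x-1)y(y-1)(x-y)) over all x, y.
  Let E be the sum of chi(x^3-x) over all x. Expressing the product (x^2-1)(y^2-1) in
  E^2 through xy and (x+y)^2 yields E^2 = D + 2q, and Jacobsthal's identity makes
  q = (E/2)^2 + (F/2)^2 a sum of two squares.
  Modulo p, E is up to sign the binomial coefficient ((q-1)/2 choose (q-1)/4), which is
  nonzero by Lucas, so this representation is primitive; a primitive representation of p^l as a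
  sum of two squares is unique up to signs and order, hence it is the one given by
  (e_1 + 2 f_1 i)^l.
*)
theory Submission
  imports Defs "HOL-Computational_Algebra.Polynomial" "HOL-Combinatorics.Multiset_Permutations"
begin

section \<open>The quadratic character of a finite field\<close>

text \<open>Nothing links the sums over \<open>p ^ l\<close> elements directly to those over
  \<open>p\<close> elements. Instead of lifting characters along the extension, \<open>E\<close> is
  studied over the large field alone and identified by arithmetic afterwards. Being a sum of two
  squares does not suffice for this: from \<open>l = 2\<close> on, \<open>p ^ l\<close> also has
  imprimitive representations, \<open>p\<close> times one of \<open>p ^ (l - 2)\<close>. That is why
  \<open>E\<close> must be known modulo \<open>p\<close>. Jacobsthal's identity does not say which
  of the two squares is odd either; this is read off from the integrality of the edge count.

  Geometrically, \<open>E\<close> is up to sign the Frobenius trace of the curve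
  \<open>y^2 = x^3 - x\<close>, which has complex multiplication by i. With
  \<open>pi = (E + F i) / 2\<close> of norm \<open>q\<close>, the identity
  \<open>E^2 = D + 2 q\<close> says that \<open>D\<close> is the sum of \<open>pi^2\<close> and its
  conjugate.\<close>

definition qchar :: "'a::field \<Rightarrow> int" where
  "qchar x = (if x = 0 then 0 else if \<exists>y. x = y\<^sup>2 then 1 else -1)"

lemma qchar_cases: "qchar x = 0 \<or> qchar x = 1 \<or> qchar x = -1"
  by (simp add: qchar_def)

lemma qchar_0 [simp]: "qchar 0 = 0"
  by (simp add: qchar_def)

lemma qchar_1 [simp]: "qchar 1 = 1"
  unfolding qchar_def by (auto intro: exI[of _ 1])

lemma qchar_eq_0_iff [simp]: "qchar x = 0 \<longleftrightarrow> x = 0"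
  by (simp add: qchar_def)

lemma qchar_square: "x \<noteq> 0 \<Longrightarrow> qchar (x\<^sup>2) = 1"
  by (auto simp: qchar_def)

lemma qchar_mult_self: "qchar x * qchar x = (if x = 0 then 0 else 1)"
  by (simp add: qchar_def)

lemma qchar_eq_1_iff: "qchar x = 1 \<longleftrightarrow> x \<in> {y\<^sup>2 | y. y \<noteq> 0}"
  by (auto simp: qchar_def)

lemma finite_field_power_card_minus_1:
  fixes x :: "'a::{field,finite}"
  assumes "x \<noteq> 0"
  shows "x ^ (CARD('a) - 1) = 1"
proof -
  have "(\<Prod>y\<in>UNIV-{0}. x * y) = (\<Prod>y\<in>UNIV-{0}. y)"
    by (rule prod.reindex_bij_witness[of _ "\<lambda>y. y / x" "\<lambda>y. x * y"]) (use assms in auto)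
  hence "x ^ (CARD('a) - 1) * (\<Prod>y\<in>UNIV-{0::'a}. y) = (\<Prod>y\<in>UNIV-{0}. y)"
    by (simp add: prod.distrib card_Diff_singleton)
  moreover have "(\<Prod>y\<in>UNIV-{0::'a}. y) \<noteq> 0"
    by simp
  ultimately show ?thesis by simp
qed

lemma card_roots_of_unity_le:
  fixes n :: nat
  assumes "n > 0"
  shows "card {x :: 'a::{comm_ring_1,ring_no_zero_divisors}. x ^ n = 1} \<le> n"
proof -
  define P :: "'a poly" where "P = monom 1 n - 1"
  have "coeff P n = 1" using assms by (simp add: P_def)
  hence "P \<noteq> 0" by force
  have "degree P \<le> n"
    unfolding P_def by (intro degree_diff_le) (auto simp: degree_monom_le)
  moreover have "{x. poly P x = 0} = {x. x ^ n = 1}"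
    by (auto simp: P_def poly_monom)
  ultimately show ?thesis
    using card_poly_roots_bound[OF \<open>P \<noteq> 0\<close>] by simp
qed

lemma sum_UNIV_add:
  fixes c :: "'a::{ab_group_add,finite}"
  shows "(\<Sum>x\<in>UNIV. f (x + c)) = (\<Sum>x\<in>UNIV. f x)"
  by (rule sum.reindex_bij_witness[of _ "\<lambda>x. x - c" "\<lambda>x. x + c"]) auto

lemma sum_UNIV_mult:
  fixes c :: "'a::{field,finite}"
  assumes "c \<noteq> 0"
  shows "(\<Sum>x\<in>UNIV. f (c * x)) = (\<Sum>x\<in>UNIV. f x)"
  by (rule sum.reindex_bij_witness[of _ "\<lambda>x. x / c" "\<lambda>x. c * x"]) (use assms in auto)

lemma sum_UNIV_diff_left:
  fixes c :: "'a::{ab_group_add,finite}"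
  shows "(\<Sum>x\<in>UNIV. f (c - x)) = (\<Sum>x\<in>UNIV. f x)"
  by (rule sum.reindex_bij_witness[of _ "\<lambda>x. c - x" "\<lambda>x. c - x"]) auto

lemma sum_UNIV_inverse:
  fixes f :: "'a::{field,finite} \<Rightarrow> 'b::comm_monoid_add"
  shows "(\<Sum>x\<in>UNIV. f (inverse x)) = (\<Sum>x\<in>UNIV. f x)"
  by (rule sum.reindex_bij_witness[of _ inverse inverse]) auto

text \<open>\<open>q\<close> is a parameter so that the results can be instantiated with the terms
  \<open>p ^ l\<close> and \<open>p\<close>, the two field sizes of the theorem.\<close>

locale paley_field =
  fixes field_type :: "'a::{field,finite} itself" and q :: nat
  assumes card_field [simp]: "CARD('a) = q"
    and card_mod_4: "q mod 4 = 1"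
begin

lemma q_gt_1: "q > 1"
  using card_mono[of "UNIV :: 'a set" "{0, 1}"] by simp

lemma fermat: "x \<noteq> 0 \<Longrightarrow> x ^ (q - 1) = (1::'a)"
  using finite_field_power_card_minus_1[of x] by simp

lemma half_q: "2 * (q div 2) = q - 1" "even (q div 2)" "q div 2 > 0"
  using card_mod_4 q_gt_1 by presburger+

lemma two_neq_0: "(2::'a) \<noteq> 0"
proof
  assume "(2::'a) = 0"
  hence "of_nat 2 = (0::'a)" by simp
  hence "CHAR('a) dvd 2" using of_nat_eq_0_iff_char_dvd by blast
  moreover have "prime CHAR('a)"
    by (rule prime_CHAR_semidom) (simp add: finite_imp_CHAR_pos)
  ultimately have "CHAR('a) = 2"
    using primes_dvd_imp_eq two_is_prime_nat by blast
  with CHAR_dvd_CARD[where ?'a='a] have "even q" by simp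
  with card_mod_4 show False by presburger
qed

lemma four_neq_0: "(4::'a) \<noteq> 0"
  using two_neq_0 by (metis mult_2 mult_eq_0_iff numeral_Bit0)

lemma minus_one_neq_one [simp]: "(-1::'a) \<noteq> 1" "(1::'a) \<noteq> -1"
  using two_neq_0 by (metis add.right_inverse one_add_one)+

lemma card_sqrt:
  "int (card {y::'a. y\<^sup>2 = x}) = 1 + qchar x"
proof -
  consider "x = 0" | y where "x = y\<^sup>2" "y \<noteq> 0" | "x \<noteq> 0" "\<nexists>y. x = y\<^sup>2"
    by (metis power_zero_numeral)
  then show ?thesis
  proof cases
    case 2
    have "y \<noteq> - y"
      using 2(2) two_neq_0 by (metis add_cancel_right_left eq_neg_iff_add_eq_0 mult_2 mult_eq_0_iff)
    moreover have "{z::'a. z\<^sup>2 = x} = {y, -y}"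
      using 2(1) by (auto simp: power2_eq_iff)
    ultimately show ?thesis using 2 by (simp add: qchar_square)
  next
    case 3
    hence "{y::'a. y\<^sup>2 = x} = {}" by auto
    then show ?thesis using 3 by (simp add: qchar_def)
  qed simp
qed

text \<open>The fibre of squaring over \<open>x\<close> has \<open>1 + qchar x\<close> elements, at
  \<open>x = 0\<close> too. All later substitutions of a square rest on this weight.\<close>

lemma sum_squares:
  fixes f :: "'a \<Rightarrow> int"
  shows "(\<Sum>y\<in>UNIV. f (y\<^sup>2)) = (\<Sum>x\<in>UNIV. (1 + qchar x) * f x)"
proof -
  have "(\<Sum>y\<in>UNIV. f (y\<^sup>2)) = (\<Sum>x\<in>UNIV. \<Sum>y | y \<in> UNIV \<and> y\<^sup>2 = x. f (y\<^sup>2))"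
    by (rule sum.group[symmetric]) auto
  also have "\<dots> = (\<Sum>x\<in>UNIV. (1 + qchar x) * f x)"
    by (intro sum.cong) (auto simp: card_sqrt[symmetric])
  finally show ?thesis .
qed

text \<open>Two bounds meet: squaring is at most two-to-one on the \<open>q - 1\<close> nonzero
  elements, which gives at least \<open>q div 2\<close> squares, and all of these are roots of a
  polynomial of degree \<open>q div 2\<close>.\<close>

lemma squares_eq_roots_of_unity:
  "{y\<^sup>2 | y::'a. y \<noteq> 0} = {x. x ^ (q div 2) = 1}"
  and card_nonzero_squares: "card {y\<^sup>2 | y::'a. y \<noteq> 0} = q div 2"
proof -
  let ?S = "{y\<^sup>2 | y::'a. y \<noteq> 0}" and ?R = "{x::'a. x ^ (q div 2) = 1}"
  have sub: "?S \<subseteq> ?R"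
    using half_q(1) fermat by (auto simp flip: power_mult)
  have "q - 1 = card (UNIV - {0::'a})"
    by (simp add: card_Diff_singleton)
  also have "UNIV - {0::'a} = (\<Union>x\<in>?S. {y. y\<^sup>2 = x})"
    by auto
  also have "card \<dots> \<le> (\<Sum>x\<in>?S. card {y::'a. y\<^sup>2 = x})"
    by (rule card_UN_le) simp
  also have "\<dots> \<le> (\<Sum>x\<in>?S. 2)"
  proof (rule sum_mono)
    fix x :: 'a
    have "int (card {y::'a. y\<^sup>2 = x}) \<le> 2" using card_sqrt[of x] qchar_cases[of x] by auto
    thus "card {y::'a. y\<^sup>2 = x} \<le> 2" by simp
  qed
  finally have "q div 2 \<le> card ?S" using half_q by simp
  moreover have "card ?R \<le> q div 2" using half_q(3) by (rule card_roots_of_unity_le)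
  moreover have "card ?S \<le> card ?R" using sub by (intro card_mono) auto
  ultimately have *: "card ?S = q div 2" "card ?S = card ?R" by linarith+
  from *(1) show "card ?S = q div 2" .
  from *(2) sub show "?S = ?R" by (intro card_subset_eq) auto
qed

text \<open>Euler's criterion. It yields multiplicativity of the character, and later the residues
  of character sums modulo \<open>p\<close>.\<close>

lemma of_int_qchar: "of_int (qchar x) = (x::'a) ^ (q div 2)"
proof (cases "x = 0")
  case True
  thus ?thesis using half_q(3) by (simp only: qchar_0 of_int_0 zero_power)
next
  case False
  have "(x ^ (q div 2))\<^sup>2 = x ^ (2 * (q div 2))"
    by (simp only: power_mult[symmetric] mult.commute)
  also have "\<dots> = 1"
    unfolding half_q(1) by (rule fermat[OF False])
  finally have "x ^ (q div 2) = 1 \<or> x ^ (q div 2) = -1"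
    by (simp only: power2_eq_1_iff)
  moreover have "qchar x = 1 \<longleftrightarrow> x ^ (q div 2) = 1"
    using squares_eq_roots_of_unity unfolding qchar_eq_1_iff by blast
  moreover have "qchar x = 1 \<or> qchar x = -1"
    using False qchar_cases[of x] by simp
  ultimately show ?thesis
    by (metis of_int_1 of_int_minus)
qed

text \<open>Powers are multiplicative, and \<open>of_int\<close> is injective on
  \<open>{0, 1, -1}\<close> because \<open>1\<close> and \<open>-1\<close> differ in the
  field.\<close>

lemma qchar_mult [simp]: "qchar (x * y) = qchar x * qchar (y::'a)"
proof -
  have inj: "a = b" if "of_int a = (of_int b :: 'a)" "a \<in> {0, 1, -1}" "b \<in> {0, 1, -1}" for a b
    using that by (elim insertE) simp_all
  show ?thesis
  proof (rule inj)
    show "of_int (qchar (x * y)) = (of_int (qchar x * qchar y) :: 'a)"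
      by (simp only: of_int_mult of_int_qchar power_mult_distrib)
    show "qchar (x * y) \<in> {0, 1, -1}"
      using qchar_cases[of "x * y"] by blast
    show "qchar x * qchar y \<in> {0, 1, -1}"
      using qchar_cases[of x] qchar_cases[of y] by (elim disjE) simp_all
  qed
qed

text \<open>\<open>q div 2\<close> is even because \<open>q\<close> is 1 modulo 4. This makes Paley
  adjacency symmetric and lets differences be reversed freely.\<close>

lemma qchar_minus_1 [simp]: "qchar (-1::'a) = 1"
proof -
  have "of_int (qchar (-1::'a)) = (1::'a)"
    using half_q(2) by (simp add: of_int_qchar)
  thus ?thesis using qchar_cases[of "-1::'a"] 
    by (elim disjE) simp_all
qed

lemma qchar_minus [simp]: "qchar (- x) = qchar (x::'a)"
  using qchar_mult[of "-1" x] unfolding qchar_minus_1 by simp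

lemma qchar_diff_commute: "qchar (x - y) = qchar (y - x :: 'a)"
  using qchar_minus[of "x - y"] unfolding minus_diff_eq by (rule sym)

lemma qchar_power2: "qchar (x\<^sup>2) = (if (x::'a) = 0 then 0 else 1)"
  by (simp add: qchar_square)

lemma qchar_4 [simp]: "qchar (4::'a) = 1"
  using qchar_square[OF two_neq_0] by simp

lemma qchar_divide [simp]: "qchar (x / y) = qchar x * qchar (y::'a)"
proof (cases "y = 0")
  case False
  have "qchar x = qchar (x / y) * qchar y" using False qchar_mult[of "x / y" y] by simp
  hence "qchar x * qchar y = qchar (x / y) * (qchar y * qchar y)" by simp
  thus ?thesis using False by (simp add: qchar_mult_self)
qed simp

section \<open>Complete character sums over one or two linear factors\<close>

lemma exists_nonsquare: obtains n :: 'a where "qchar n = -1"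
proof -
  have "{y\<^sup>2 | y::'a. y \<noteq> 0} \<noteq> UNIV - {0}"
  proof
    assume "{y\<^sup>2 | y::'a. y \<noteq> 0} = UNIV - {0}"
    hence "q div 2 = q - 1" using card_nonzero_squares by (simp add: card_Diff_singleton)
    thus False using half_q by simp
  qed
  then obtain n :: 'a where "n \<noteq> 0" "n \<notin> {y\<^sup>2 | y::'a. y \<noteq> 0}" by auto
  hence "qchar n = -1" by (auto simp: qchar_def)
  thus ?thesis by (rule that)
qed

text \<open>Scaling the variable by a nonsquare negates the sum.\<close>

lemma sum_qchar: "(\<Sum>x\<in>UNIV. qchar (x::'a)) = 0"
proof -
  obtain n :: 'a where n: "qchar n = -1" by (rule exists_nonsquare)
  hence "n \<noteq> 0" by auto
  from sum_UNIV_mult[OF this, of qchar] n show ?thesis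
    by (simp add: sum_negf)
qed

lemma sum_qchar_diff: "(\<Sum>x\<in>UNIV. qchar (x - c :: 'a)) = 0"
  using sum_UNIV_add[of qchar "-c"] sum_qchar by simp

lemma sum_qchar_diff_left: "(\<Sum>x\<in>UNIV. qchar (c - x :: 'a)) = 0"
  using sum_qchar_diff[of c] by (simp add: qchar_diff_commute)

text \<open>For distinct shifts the product becomes \<open>x * (x + c) = x^2 * (1 + c / x)\<close>.
  As \<open>x\<close> runs through the nonzero elements, \<open>1 + c / x\<close> takes every value
  except 1, so what remains is the full sum 0 minus \<open>qchar 1\<close>.\<close>

lemma sum_qchar_qchar:
  "(\<Sum>x\<in>UNIV. qchar (x - a) * qchar (x - b :: 'a)) = (if a = b then int q else 0) - 1"
proof (cases "a = b")
  case True
  have "(\<Sum>x\<in>UNIV. qchar (x - a) * qchar (x - a)) = (\<Sum>x\<in>UNIV-{a}. 1)"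
    by (rule sum.mono_neutral_cong_right) (auto simp: qchar_mult_self)
  thus ?thesis using True q_gt_1 by (simp add: card_Diff_singleton)
next
  case False
  define c where "c = a - b"
  have c: "c \<noteq> 0" using False by (simp add: c_def)
  have "(\<Sum>x\<in>UNIV. qchar (x - a) * qchar (x - b)) = (\<Sum>x\<in>UNIV. qchar x * qchar (x + c))"
    using sum_UNIV_add[of "\<lambda>x. qchar x * qchar (x + c)" "-a"] by (simp add: c_def algebra_simps)
  also have "\<dots> = (\<Sum>x\<in>UNIV-{0}. qchar (1 + c / x))"
  proof (rule sum.mono_neutral_cong_right; clarsimp)
    fix x :: 'a assume x: "x \<noteq> 0"
    have "x * (x + c) = x\<^sup>2 * (1 + c / x)"
      using x by (simp add: field_simps power2_eq_square)
    hence "qchar x * qchar (x + c) = qchar (x\<^sup>2) * qchar (1 + c / x)"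
      by (metis qchar_mult)
    thus "qchar x * qchar (x + c) = qchar (1 + c / x)" using x by (simp add: qchar_power2)
  qed
  also have "\<dots> = (\<Sum>z\<in>UNIV-{1::'a}. qchar z)"
    by (rule sum.reindex_bij_witness[of _ "\<lambda>z. c / (z - 1)" "\<lambda>x. 1 + c / x"])
       (use c in \<open>auto simp: field_simps\<close>)
  also have "\<dots> = -1"
    using sum_qchar by (simp add: sum_diff1)
  finally show ?thesis using False by simp
qed

lemma sum_qchar_qchar_0:
  "(\<Sum>x\<in>UNIV. qchar x * qchar (x - b :: 'a)) = (if b = 0 then int q else 0) - 1"
  using sum_qchar_qchar[of 0 b] by simp

end

section \<open>Character sums and Jacobsthal sums\<close>

context paley_field begin

text \<open>\<open>q + legendre_sum c\<close> is the number of affine points of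
  \<open>y^2 = x (x - 1) (x - c)\<close>, the Legendre curve.\<close>

definition legendre_sum :: "'a \<Rightarrow> int" where
  "legendre_sum c = (\<Sum>x\<in>UNIV. qchar x * qchar (x - 1) * qchar (x - c))"

definition double_sum :: int where
  "double_sum = (\<Sum>c\<in>UNIV. qchar (c::'a) * qchar (c - 1) * legendre_sum c)"

text \<open>At \<open>a = -1\<close> this is the sum \<open>E\<close>. The parameter is there
  because the two squares come from a second moment over all \<open>a\<close>.\<close>

definition jacobsthal_sum :: "'a \<Rightarrow> int" where
  "jacobsthal_sum a = (\<Sum>x\<in>UNIV. qchar x * qchar (x\<^sup>2 + a))"

lemma sum_if_eq: "(\<Sum>x\<in>UNIV. f x * (if x = c then k else 0)) = (f (c::'a) * k :: int)"
proof -
  have "(\<Sum>x\<in>UNIV. f x * (if x = c then k else 0)) = (\<Sum>x\<in>UNIV. if x = c then f c * k else 0)"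
    by (intro sum.cong) auto
  thus ?thesis by simp
qed

section \<open>Moments of the Legendre sums\<close>

lemma sum_qchar_legendre_sum:
  "(\<Sum>c\<in>UNIV. qchar c * legendre_sum c) = (1::int)"
proof -
  have "(\<Sum>c\<in>UNIV. qchar c * legendre_sum c)
      = (\<Sum>x\<in>UNIV. \<Sum>c\<in>UNIV. qchar c * (qchar x * qchar (x - 1) * qchar (x - c :: 'a)))"
    unfolding legendre_sum_def sum_distrib_left by (rule sum.swap)
  also have "\<dots> = (\<Sum>x\<in>UNIV. qchar x * qchar (x - 1) * (\<Sum>c\<in>UNIV. qchar c * qchar (c - x :: 'a)))"
    unfolding sum_distrib_left by (intro sum.cong refl) (subst qchar_diff_commute, simp add: mult_ac)
  \<comment> \<open>The inner sum is not \<open>-1\<close> at \<open>x = 0\<close>, but there the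
    factor \<open>qchar x\<close> vanishes.\<close>
  also have "\<dots> = (\<Sum>x\<in>UNIV. qchar x * qchar (x - 1 :: 'a) * -1)"
    unfolding sum_qchar_qchar_0 by (intro sum.cong) auto
  also have "\<dots> = 1"
    unfolding sum_distrib_right[symmetric] sum_qchar_qchar_0 by simp
  finally show ?thesis .
qed

lemma sum_qchar_shift_legendre_sum:
  "(\<Sum>c\<in>UNIV. qchar (c - 1) * legendre_sum c) = (1::int)"
proof -
  have "(\<Sum>c\<in>UNIV. qchar (c - 1) * legendre_sum c)
      = (\<Sum>x\<in>UNIV. \<Sum>c\<in>UNIV. qchar (c - 1) * (qchar x * qchar (x - 1) * qchar (x - c :: 'a)))"
    unfolding legendre_sum_def sum_distrib_left by (rule sum.swap)
  also have "\<dots> = (\<Sum>x\<in>UNIV. qchar x * qchar (x - 1) * (\<Sum>c\<in>UNIV. qchar (c - 1) * qchar (c - x :: 'a)))"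
    unfolding sum_distrib_left
    by (intro sum.cong refl) (subst (3) qchar_diff_commute, simp add: mult_ac)
  also have "\<dots> = (\<Sum>x\<in>UNIV. qchar x * qchar (x - 1 :: 'a) * -1)"
    unfolding sum_qchar_qchar by (intro sum.cong) auto
  also have "\<dots> = 1"
    unfolding sum_distrib_right[symmetric] sum_qchar_qchar_0 by simp
  finally show ?thesis .
qed

lemma sum_legendre_sum: "(\<Sum>c\<in>UNIV. legendre_sum c) = (0::int)"
proof -
  have "(\<Sum>c\<in>UNIV. legendre_sum c)
      = (\<Sum>x\<in>UNIV. \<Sum>c\<in>UNIV. qchar x * qchar (x - 1) * qchar (x - c :: 'a))"
    unfolding legendre_sum_def by (rule sum.swap)
  thus ?thesis
    by (simp add: sum_distrib_left[symmetric] sum_qchar_diff_left)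
qed

lemma legendre_sum_0: "legendre_sum 0 = -1"
proof -
  have "legendre_sum 0 = (\<Sum>x\<in>UNIV-{0::'a}. qchar (x - 1))"
    unfolding legendre_sum_def
    by (rule sum.mono_neutral_cong_right) (auto simp: mult.commute mult.assoc[symmetric] qchar_mult_self)
  also have "\<dots> = -1" by (simp add: sum_diff1 sum_qchar_diff)
  finally show ?thesis .
qed

lemma legendre_sum_1: "legendre_sum 1 = -1"
proof -
  have "legendre_sum 1 = (\<Sum>x\<in>UNIV-{1::'a}. qchar x)"
    unfolding legendre_sum_def
    by (rule sum.mono_neutral_cong_right) (auto simp: mult.assoc qchar_mult_self)
  also have "\<dots> = -1" by (simp add: sum_diff1 sum_qchar)
  finally show ?thesis .
qed

lemma legendre_sum_scale:
  assumes "a \<noteq> 0"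
  shows "(\<Sum>w\<in>UNIV. qchar w * qchar (w - b) * qchar (w - a\<^sup>2)) = legendre_sum (b / a\<^sup>2)"
proof -
  have "(\<Sum>w\<in>UNIV. qchar w * qchar (w - b) * qchar (w - a\<^sup>2))
      = (\<Sum>v\<in>UNIV. qchar (a\<^sup>2 * v) * qchar (a\<^sup>2 * v - b) * qchar (a\<^sup>2 * v - a\<^sup>2))"
    using assms by (intro sum_UNIV_mult[symmetric]) simp
  also have "\<dots> = legendre_sum (b / a\<^sup>2)"
    unfolding legendre_sum_def
  proof (rule sum.cong)
    fix v :: 'a
    have "a\<^sup>2 * v - b = a\<^sup>2 * (v - b / a\<^sup>2)" "a\<^sup>2 * v - a\<^sup>2 = a\<^sup>2 * (v - 1)"
      using assms by (simp_all add: field_simps)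
    thus "qchar (a\<^sup>2 * v) * qchar (a\<^sup>2 * v - b) * qchar (a\<^sup>2 * v - a\<^sup>2)
        = qchar v * qchar (v - 1) * qchar (v - b / a\<^sup>2)"
      using assms by (simp add: qchar_power2 mult_ac)
  qed simp
  finally show ?thesis .
qed

text \<open>The parametrisation \<open>c = 4 s / (s + 1)\<^sup>2\<close> equals \<open>1 - (2 / (s + 1) - 1)\<^sup>2\<close>, also for
  \<open>s = -1\<close> where both sides are \<open>0\<close> because of \<open>x / 0 = 0\<close>.\<close>

lemma sum_parametrised:
  fixes f :: "'a \<Rightarrow> int"
  shows "(\<Sum>s\<in>UNIV. f (4 * s / (s + 1)\<^sup>2)) = (\<Sum>c\<in>UNIV. (1 + qchar (c - 1)) * f c)"
proof -
  have "4 * (t - 1) / t\<^sup>2 = 1 - (2 * inverse t - 1)\<^sup>2" for t :: 'a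
    by (cases "t = 0") (simp_all add: field_simps power2_eq_square)
  from this[of "_ + 1"] have "4 * s / (s + 1)\<^sup>2 = 1 - (2 * inverse (s + 1) - 1)\<^sup>2" for s :: 'a
    by simp
  hence "(\<Sum>s\<in>UNIV. f (4 * s / (s + 1)\<^sup>2)) = (\<Sum>s\<in>UNIV. f (1 - (2 * inverse (s + 1) - 1)\<^sup>2))"
    by simp
  also have "\<dots> = (\<Sum>s\<in>UNIV. f (1 - (2 * inverse s - 1)\<^sup>2))"
    by (rule sum_UNIV_add[of "\<lambda>s. f (1 - (2 * inverse s - 1)\<^sup>2)"])
  \<comment> \<open>With \<open>inverse 0 = 0\<close>, inversion permutes the whole field and no
    point has to be excluded.\<close>
  also have "\<dots> = (\<Sum>s\<in>UNIV. f (1 - (2 * s - 1)\<^sup>2))"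
    by (rule sum_UNIV_inverse[of "\<lambda>s. f (1 - (2 * s - 1)\<^sup>2)"])
  also have "\<dots> = (\<Sum>s\<in>UNIV. f (1 - (s - 1)\<^sup>2))"
    by (rule sum_UNIV_mult[of 2 "\<lambda>s. f (1 - (s - 1)\<^sup>2)"]) (rule two_neq_0)
  also have "\<dots> = (\<Sum>s\<in>UNIV. f (1 - s\<^sup>2))"
    using sum_UNIV_add[of "\<lambda>s. f (1 - s\<^sup>2)" "-1"] by simp
  also have "\<dots> = (\<Sum>s\<in>UNIV. (1 + qchar s) * f (1 - s))"
    by (rule sum_squares[of "\<lambda>s. f (1 - s)"])
  also have "\<dots> = (\<Sum>c\<in>UNIV. (1 + qchar (1 - c)) * f (1 - (1 - c)))"
    by (rule sum_UNIV_diff_left[symmetric, of _ 1])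
  finally show ?thesis by (simp add: qchar_diff_commute)
qed

text \<open>Scaling by \<open>(s + 1)^2\<close> turns the inner sum into
  \<open>legendre_sum c\<close> at \<open>c = 4 s / (s + 1)^2\<close>, and
  \<open>qchar s = qchar c\<close>. The weight \<open>1 + qchar (c - 1)\<close> of the
  parametrisation then gives \<open>1 + double_sum\<close>; the excess 1 is cancelled by the
  degenerate point \<open>s = -1\<close>.\<close>

lemma sum_qchar_scaled_legendre_sum:
  "(\<Sum>s\<in>UNIV. qchar s * (\<Sum>w\<in>UNIV. qchar w * qchar (w - 4 * s) * qchar (w - (s + 1 :: 'a)\<^sup>2))) = double_sum"
  (is "(\<Sum>s\<in>UNIV. ?g s) = _")
proof -
  define f where "f c = qchar c * legendre_sum c" for c
  have "?g s = f (4 * s / (s + 1)\<^sup>2) - (if s = -1 then 1 else 0)" for s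
  proof (cases "s = -1")
    case True
    have "(\<Sum>w\<in>UNIV. qchar w * qchar (w + 4) * qchar (w::'a)) = (\<Sum>w\<in>UNIV-{0::'a}. qchar (w - (-4)))"
      by (rule sum.mono_neutral_cong_right) (auto simp: mult_ac qchar_def)
    also have "\<dots> = -1"
      unfolding sum_diff1[OF finite] sum_qchar_diff by simp
    finally show ?thesis using True by (simp add: f_def)
  next
    case False
    hence "s + 1 \<noteq> 0" by (simp add: eq_neg_iff_add_eq_0)
    thus ?thesis using False unfolding legendre_sum_scale[OF \<open>s + 1 \<noteq> 0\<close>] f_def
      by (simp add: qchar_power2)
  qed
  hence "(\<Sum>s\<in>UNIV. ?g s) = (\<Sum>s\<in>UNIV. f (4 * s / (s + 1)\<^sup>2)) - 1"
    by (simp add: sum_subtractf)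
  also have "(\<Sum>s\<in>UNIV. f (4 * s / (s + 1)\<^sup>2)) = (\<Sum>c\<in>UNIV. f c + qchar c * qchar (c - 1) * legendre_sum c)"
    unfolding sum_parametrised by (intro sum.cong) (simp_all add: f_def algebra_simps)
  also have "\<dots> = 1 + double_sum"
    by (simp add: sum.distrib f_def sum_qchar_legendre_sum double_sum_def)
  finally show ?thesis by simp
qed

text \<open>Substituting \<open>s = x y\<close>, \<open>u = x + y\<close> and then \<open>s = u\<^sup>2/4 - (x - u/2)\<^sup>2\<close>.\<close>

lemma sum_product_sum:
  fixes f :: "'a \<Rightarrow> 'a \<Rightarrow> int"
  shows "(\<Sum>x\<in>UNIV. \<Sum>y\<in>UNIV. f (x * y) ((x + y)\<^sup>2))
    = (\<Sum>s\<in>UNIV. \<Sum>w\<in>UNIV. (1 + qchar w) * (1 + qchar (w - 4 * s)) * f s w)"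
proof -
  have "(\<Sum>x\<in>UNIV. \<Sum>y\<in>UNIV. f (x * y) ((x + y)\<^sup>2)) = (\<Sum>x\<in>UNIV. \<Sum>u\<in>UNIV. f (x * (u - x)) (u\<^sup>2))"
  proof (rule sum.cong)
    fix x :: 'a
    show "(\<Sum>y\<in>UNIV. f (x * y) ((x + y)\<^sup>2)) = (\<Sum>u\<in>UNIV. f (x * (u - x)) (u\<^sup>2))"
      using sum_UNIV_add[of "\<lambda>u. f (x * (u - x)) (u\<^sup>2)" x] by (simp add: add.commute)
  qed simp
  also have "\<dots> = (\<Sum>u\<in>UNIV. \<Sum>x\<in>UNIV. f (x * (u - x)) (u\<^sup>2))"
    by (rule sum.swap)
  also have "\<dots> = (\<Sum>u\<in>UNIV. \<Sum>s\<in>UNIV. (1 + qchar (u\<^sup>2 - 4 * s)) * f s (u\<^sup>2))"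
  proof (rule sum.cong)
    fix u :: 'a
    have "(\<Sum>x\<in>UNIV. f (x * (u - x)) (u\<^sup>2)) = (\<Sum>x\<in>UNIV. f ((x + u / 2) * (u - (x + u / 2))) (u\<^sup>2))"
      by (rule sum_UNIV_add[symmetric])
    also have "\<dots> = (\<Sum>x\<in>UNIV. f (u\<^sup>2 / 4 - x\<^sup>2) (u\<^sup>2))"
    proof (rule sum.cong)
      fix x :: 'a
      define h where "h = u / 2"
      have u: "u = 2 * h" using two_neq_0 by (simp add: h_def)
      have "(x + h) * (u - (x + h)) = h\<^sup>2 - x\<^sup>2"
        unfolding u by (simp add: algebra_simps power2_eq_square)
      moreover have "h\<^sup>2 = u\<^sup>2 / 4" by (simp add: h_def power_divide)
      ultimately show "f ((x + u / 2) * (u - (x + u / 2))) (u\<^sup>2) = f (u\<^sup>2 / 4 - x\<^sup>2) (u\<^sup>2)"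
        by (simp only: h_def)
    qed simp
    also have "\<dots> = (\<Sum>w\<in>UNIV. (1 + qchar w) * f (u\<^sup>2 / 4 - w) (u\<^sup>2))"
      by (rule sum_squares[of "\<lambda>w. f (u\<^sup>2 / 4 - w) (u\<^sup>2)"])
    also have "\<dots> = (\<Sum>s\<in>UNIV. (1 + qchar (u\<^sup>2 / 4 - s)) * f (u\<^sup>2 / 4 - (u\<^sup>2 / 4 - s)) (u\<^sup>2))"
      by (rule sum_UNIV_diff_left[symmetric])
    also have "\<dots> = (\<Sum>s\<in>UNIV. (1 + qchar (u\<^sup>2 - 4 * s)) * f s (u\<^sup>2))"
    proof (rule sum.cong)
      fix s :: 'a
      have "u\<^sup>2 / 4 - s = (u\<^sup>2 - 4 * s) / 4" using four_neq_0 by (simp add: field_simps)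
      hence "qchar (u\<^sup>2 / 4 - s) = qchar (u\<^sup>2 - 4 * s)" by (simp only: qchar_divide qchar_4 mult_1_right)
      thus "(1 + qchar (u\<^sup>2 / 4 - s)) * f (u\<^sup>2 / 4 - (u\<^sup>2 / 4 - s)) (u\<^sup>2)
          = (1 + qchar (u\<^sup>2 - 4 * s)) * f s (u\<^sup>2)" by simp
    qed simp
    finally show "(\<Sum>x\<in>UNIV. f (x * (u - x)) (u\<^sup>2)) = (\<Sum>s\<in>UNIV. (1 + qchar (u\<^sup>2 - 4 * s)) * f s (u\<^sup>2))" .
  qed simp
  also have "\<dots> = (\<Sum>w\<in>UNIV. (1 + qchar w) * (\<Sum>s\<in>UNIV. (1 + qchar (w - 4 * s)) * f s w))"
    by (rule sum_squares)
  also have "\<dots> = (\<Sum>s\<in>UNIV. \<Sum>w\<in>UNIV. (1 + qchar w) * (1 + qchar (w - 4 * s)) * f s w)"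
    unfolding sum_distrib_left mult.assoc by (rule sum.swap)
  finally show ?thesis .
qed

theorem jacobsthal_sum_squared: "(jacobsthal_sum (-1))\<^sup>2 = double_sum + 2 * int q"
proof -
  define A where "A s w = qchar (w - (s + 1)\<^sup>2)" for s w :: 'a
  have "(jacobsthal_sum (-1))\<^sup>2
      = (\<Sum>x\<in>UNIV. \<Sum>y\<in>UNIV. (qchar x * qchar (x\<^sup>2 - 1 :: 'a)) * (qchar y * qchar (y\<^sup>2 - 1 :: 'a)))"
    by (simp add: jacobsthal_sum_def power2_eq_square sum_product)
  also have "\<dots> = (\<Sum>x\<in>UNIV. \<Sum>y\<in>UNIV. qchar (x * y) * A (x * y) ((x + y :: 'a)\<^sup>2))"
  proof (intro sum.cong refl)
    fix x y :: 'a
    have "(x\<^sup>2 - 1) * (y\<^sup>2 - 1) = - ((x + y)\<^sup>2 - (x * y + 1)\<^sup>2)"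
      by (simp add: power2_eq_square algebra_simps)
    hence "qchar (x\<^sup>2 - 1) * qchar (y\<^sup>2 - 1) = A (x * y) ((x + y)\<^sup>2)"
      by (metis A_def qchar_minus qchar_mult)
    thus "(qchar x * qchar (x\<^sup>2 - 1)) * (qchar y * qchar (y\<^sup>2 - 1)) = qchar (x * y) * A (x * y) ((x + y)\<^sup>2)"
      by (simp add: mult_ac)
  qed
  also have "\<dots> = (\<Sum>s\<in>UNIV. \<Sum>w\<in>UNIV. (1 + qchar w) * (1 + qchar (w - 4 * s)) * (qchar s * A s w))"
    by (rule sum_product_sum)
  \<comment> \<open>Of the four sums obtained by expanding the weight, the last is
    \<open>double_sum\<close>. The others are elementary: two roots in \<open>w\<close> coincide
    only for \<open>s = -1\<close> and for \<open>s = 1\<close>, and each of these contributes one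
    \<open>q\<close>.\<close>
  also have "\<dots> = (\<Sum>s\<in>UNIV. qchar s * (\<Sum>w\<in>UNIV. A s w) + qchar s * (\<Sum>w\<in>UNIV. qchar w * A s w)
      + qchar s * (\<Sum>w\<in>UNIV. qchar (w - 4 * s) * A s w)
      + qchar s * (\<Sum>w\<in>UNIV. qchar w * qchar (w - 4 * s) * A s w))"
    by (intro sum.cong refl) (simp add: algebra_simps sum.distrib sum_distrib_left)
  also have "\<dots> = (\<Sum>s\<in>UNIV. qchar (s::'a) * (if s = -1 then int q else 0))
      + (\<Sum>s\<in>UNIV. qchar (s::'a) * (if s = 1 then int q else 0)) - 2 * (\<Sum>s\<in>UNIV. qchar (s::'a)) + double_sum"
  proof -
    have 1: "(s + 1)\<^sup>2 = 0 \<longleftrightarrow> s = -1" for s :: 'a by (simp add: eq_neg_iff_add_eq_0)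
    have 2: "4 * s = (s + 1)\<^sup>2 \<longleftrightarrow> s = 1" for s :: 'a
    proof -
      have "(s + 1)\<^sup>2 - 4 * s = (s - 1)\<^sup>2" by (simp add: power2_eq_square algebra_simps)
      thus ?thesis by (metis eq_iff_diff_eq_0 zero_eq_power2)
    qed
    show ?thesis
      unfolding A_def sum_qchar_diff sum_qchar_qchar sum_qchar_qchar_0 1 2 sum.distrib
        sum_qchar_scaled_legendre_sum
      by (simp add: right_diff_distrib sum_subtractf)
  qed
  also have "\<dots> = double_sum + 2 * int q"
    by (simp only: sum_if_eq sum_qchar) simp
  finally show ?thesis .
qed

section \<open>Second moments of Jacobsthal sums\<close>

lemma jacobsthal_sum_scale:
  assumes "b \<noteq> 0"
  shows "jacobsthal_sum (b\<^sup>2 * a) = qchar b * jacobsthal_sum a"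
proof -
  have "jacobsthal_sum (b\<^sup>2 * a) = (\<Sum>x\<in>UNIV. qchar (b * x) * qchar ((b * x)\<^sup>2 + b\<^sup>2 * a))"
    unfolding jacobsthal_sum_def using assms by (intro sum_UNIV_mult[symmetric])
  also have "\<dots> = (\<Sum>x\<in>UNIV. qchar b * (qchar x * qchar (x\<^sup>2 + a)))"
  proof (intro sum.cong refl)
    fix x :: 'a
    have "(b * x)\<^sup>2 + b\<^sup>2 * a = b\<^sup>2 * (x\<^sup>2 + a)" by (simp add: algebra_simps power2_eq_square)
    thus "qchar (b * x) * qchar ((b * x)\<^sup>2 + b\<^sup>2 * a) = qchar b * (qchar x * qchar (x\<^sup>2 + a))"
      using assms by (simp add: qchar_power2)
  qed
  finally show ?thesis by (simp add: jacobsthal_sum_def sum_distrib_left)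
qed

text \<open>The weight restricts the sum to square multiples of \<open>a\<close>, on which the
  squared Jacobsthal sum is constant. The term at 0 vanishes because \<open>jacobsthal_sum 0\<close>
  is the plain sum of the character.\<close>

lemma sum_jacobsthal_sum_squares:
  assumes "a \<noteq> 0"
  shows "(\<Sum>b\<in>UNIV. (1 + qchar b) * (jacobsthal_sum (b * a))\<^sup>2) = (int q - 1) * (jacobsthal_sum a)\<^sup>2"
proof -
  have 0: "jacobsthal_sum 0 = 0"
    using sum_qchar unfolding jacobsthal_sum_def
    by (subst sum.cong[OF refl, where h=qchar]) (auto simp: qchar_power2)
  have "(\<Sum>b\<in>UNIV. (1 + qchar b) * (jacobsthal_sum (b * a))\<^sup>2) = (\<Sum>b\<in>UNIV. (jacobsthal_sum (b\<^sup>2 * a))\<^sup>2)"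
    by (rule sum_squares[symmetric, of "\<lambda>b. (jacobsthal_sum (b * a))\<^sup>2"])
  also have "\<dots> = (\<Sum>b\<in>UNIV-{0::'a}. (jacobsthal_sum a)\<^sup>2)"
  proof (rule sum.mono_neutral_cong_right)
    fix b :: 'a assume b: "b \<in> UNIV - {0}"
    hence "(qchar b)\<^sup>2 = 1" using qchar_mult_self[of b] by (simp add: power2_eq_square)
    thus "(jacobsthal_sum (b\<^sup>2 * a))\<^sup>2 = (jacobsthal_sum a)\<^sup>2"
      using b by (simp add: jacobsthal_sum_scale power_mult_distrib)
  qed (auto simp: 0)
  finally show ?thesis using q_gt_1 by (simp add: card_Diff_singleton of_nat_diff)
qed

text \<open>Expanding the square and summing over \<open>a\<close> first gives \<open>q - 1\<close>
  if \<open>y\<close> is \<open>x\<close> or \<open>-x\<close>, and \<open>-1\<close> otherwise. The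
  constant \<open>-1\<close> disappears when summed against \<open>qchar y\<close>, leaving
  \<open>2 q\<close> for each nonzero \<open>x\<close>.\<close>

lemma sum_jacobsthal_sum_squared: "(\<Sum>a\<in>UNIV. (jacobsthal_sum a)\<^sup>2) = 2 * int q * (int q - 1)"
proof -
  have "(\<Sum>a\<in>UNIV. (jacobsthal_sum a)\<^sup>2)
     = (\<Sum>a\<in>UNIV. \<Sum>x\<in>UNIV. \<Sum>y\<in>UNIV. (qchar x * qchar (x\<^sup>2 + a)) * (qchar y * qchar (y\<^sup>2 + a :: 'a)))"
    by (simp add: jacobsthal_sum_def power2_eq_square sum_product)
  also have "\<dots> = (\<Sum>x\<in>UNIV. \<Sum>a\<in>UNIV. \<Sum>y\<in>UNIV. (qchar x * qchar (x\<^sup>2 + a)) * (qchar y * qchar (y\<^sup>2 + a :: 'a)))"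
    by (rule sum.swap)
  also have "\<dots> = (\<Sum>x\<in>UNIV. \<Sum>y\<in>UNIV. \<Sum>a\<in>UNIV. (qchar x * qchar (x\<^sup>2 + a)) * (qchar y * qchar (y\<^sup>2 + a :: 'a)))"
    by (intro sum.cong refl sum.swap)
  also have "\<dots> = (\<Sum>x\<in>UNIV. \<Sum>y\<in>UNIV. qchar x * qchar y * (\<Sum>a\<in>UNIV. qchar (a - (- x\<^sup>2)) * qchar (a - (- y\<^sup>2 :: 'a))))"
    unfolding sum_distrib_left by (intro sum.cong refl) (simp add: add.commute)
  also have "\<dots> = (\<Sum>x\<in>UNIV. qchar x * (\<Sum>y\<in>UNIV. (if y\<^sup>2 = x\<^sup>2 then int q * qchar y else 0) - qchar (y::'a)))"
    unfolding sum_qchar_qchar sum_distrib_left by (intro sum.cong refl) (auto simp: algebra_simps)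
  also have "\<dots> = (\<Sum>x\<in>UNIV. qchar x * (\<Sum>y | y\<^sup>2 = x\<^sup>2. int q * qchar (y::'a)))"
    by (simp add: sum_subtractf sum_qchar sum.If_cases)
  also have "\<dots> = (\<Sum>x\<in>UNIV-{0::'a}. 2 * int q)"
  proof (rule sum.mono_neutral_cong_right)
    fix x :: 'a assume "x \<in> UNIV - {0}"
    hence x: "x \<noteq> 0" by simp
    hence "x \<noteq> - x"
      using two_neq_0 by (metis add_cancel_right_left eq_neg_iff_add_eq_0 mult_2 mult_eq_0_iff)
    moreover have "{y. y\<^sup>2 = x\<^sup>2} = {x, -x}" by (auto simp: power2_eq_iff)
    ultimately show "qchar x * (\<Sum>y | y\<^sup>2 = x\<^sup>2. int q * qchar y) = 2 * int q"
      using qchar_mult_self[of x] x by (simp add: algebra_simps)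
  qed auto
  finally show ?thesis using q_gt_1 by (simp add: card_Diff_singleton of_nat_diff)
qed

text \<open>The nonzero parameters split into two square classes of equal size, represented by
  \<open>-1\<close> and \<open>-n\<close>, so the second moment is \<open>(q - 1) / 2\<close> times
  the left-hand side.\<close>

theorem jacobsthal_two_squares:
  assumes "qchar n = -1"
  shows "(jacobsthal_sum (-1))\<^sup>2 + (jacobsthal_sum (-n))\<^sup>2 = 4 * int q"
proof -
  have n: "n \<noteq> 0" using assms by auto
  define g where "g b = (jacobsthal_sum (- b))\<^sup>2" for b
  have "(\<Sum>b\<in>UNIV. (1 + qchar (n * b)) * g (n * b)) = (\<Sum>b\<in>UNIV. (1 + qchar b) * g b)"
    using n by (rule sum_UNIV_mult)
  moreover have "(\<Sum>b\<in>UNIV. (1 - qchar (n * b)) * g (n * b)) = (\<Sum>b\<in>UNIV. (1 - qchar b) * g b)"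
    using n by (rule sum_UNIV_mult)
  moreover have "(\<Sum>b\<in>UNIV. (1 + qchar b) * g b) = (int q - 1) * (jacobsthal_sum (-1))\<^sup>2"
    using sum_jacobsthal_sum_squares[of "-1"] by (simp add: g_def)
  moreover have "(\<Sum>b\<in>UNIV. (1 + qchar b) * g (n * b)) = (int q - 1) * (jacobsthal_sum (-n))\<^sup>2"
    using sum_jacobsthal_sum_squares[of "-n"] n by (simp add: g_def mult.commute)
  moreover have "(\<Sum>b\<in>UNIV. (1 + qchar b) * g b) + (\<Sum>b\<in>UNIV. (1 - qchar b) * g b) = 2 * (\<Sum>b\<in>UNIV. g b)"
    unfolding sum.distrib[symmetric] sum_distrib_left by (intro sum.cong) (auto simp: algebra_simps)
  moreover have "(\<Sum>b\<in>UNIV. g b) = 2 * int q * (int q - 1)"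
    using sum_UNIV_diff_left[of "\<lambda>a. (jacobsthal_sum a)\<^sup>2" 0] sum_jacobsthal_sum_squared
    by (simp add: g_def)
  ultimately have "(int q - 1) * ((jacobsthal_sum (-1))\<^sup>2 + (jacobsthal_sum (-n))\<^sup>2) = (int q - 1) * (4 * int q)"
    using assms by (simp add: algebra_simps)
  thus ?thesis using q_gt_1 by simp
qed

end

section \<open>Counting 4-cliques\<close>

lemma card_list_sets:
  assumes "finite (\<Union>K)" "\<And>C. C \<in> K \<Longrightarrow> card C = n"
  shows "card {xs. distinct xs \<and> set xs \<in> K} = fact n * card K"
proof -
  have fin: "finite C" if "C \<in> K" for C
    using assms(1) that by (meson Union_upper finite_subset)
  have "finite K" using assms(1) by (rule finite_UnionD)
  have "{xs. distinct xs \<and> set xs \<in> K} = (\<Union>C\<in>K. permutations_of_set C)"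
    by (auto simp: permutations_of_set_def)
  also have "card \<dots> = (\<Sum>C\<in>K. card (permutations_of_set C))"
    using \<open>finite K\<close> fin
    by (intro card_UN_disjoint ballI finite_permutations_of_set) (auto simp: permutations_of_set_def)
  also have "\<dots> = fact n * card K"
    using assms(2) fin by simp
  finally show ?thesis .
qed

context paley_field begin

definition common_nbrs :: "'a set" where
  "common_nbrs = {x. qchar x = 1 \<and> qchar (x - 1) = 1}"

text \<open>Ordered pairs, so every edge is counted twice.\<close>

definition common_nbr_edges :: "('a \<times> 'a) set" where
  "common_nbr_edges = {(x, y). x \<in> common_nbrs \<and> y \<in> common_nbrs \<and> qchar (x - y) = 1}"

text \<open>The weight is \<open>(1 + qchar x) * (1 + qchar (x - 1))\<close>: it is 4 on common
  neighbours and 0 elsewhere, except for the value 2 at 0 and 1, which is subtracted.\<close>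

lemma sum_common_nbrs:
  "4 * (\<Sum>x\<in>common_nbrs. f x)
    = (\<Sum>x\<in>UNIV. (1 + qchar x + qchar (x - 1) + qchar x * qchar (x - 1)) * f x) - 2 * f 0 - (2 * f 1 :: int)"
proof -
  have "4 * (\<Sum>x\<in>common_nbrs. f x) = (\<Sum>x\<in>UNIV. if x \<in> common_nbrs then 4 * f x else 0)"
    by (simp add: sum.If_cases sum_distrib_left)
  also have "\<dots> = (\<Sum>x\<in>UNIV. (1 + qchar x + qchar (x - 1) + qchar x * qchar (x - 1)) * f x
      - (if x = 0 then 2 * f 0 else 0) - (if x = 1 then 2 * f 1 else 0))"
  proof (intro sum.cong refl)
    fix x :: 'a
    show "(if x \<in> common_nbrs then 4 * f x else 0)
      = (1 + qchar x + qchar (x - 1) + qchar x * qchar (x - 1)) * f x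
      - (if x = 0 then 2 * f 0 else 0) - (if x = 1 then 2 * f 1 else 0)"
    proof (cases "x = 0 \<or> x = 1")
      case True
      thus ?thesis by (auto simp: common_nbrs_def)
    next
      case False
      hence "x \<noteq> 0" "x \<noteq> 1" by auto
      moreover have "qchar x = 1 \<or> qchar x = -1" "qchar (x - 1) = 1 \<or> qchar (x - 1) = -1"
        using False qchar_cases[of x] qchar_cases[of "x - 1"] by auto
      ultimately show ?thesis by (auto simp: common_nbrs_def)
    qed
  qed
  finally show ?thesis by (simp add: sum_subtractf)
qed

lemma card_common_nbrs: "4 * int (card common_nbrs) = int q - 5"
proof -
  have "4 * int (card common_nbrs) = 4 * (\<Sum>x\<in>common_nbrs. 1)" by simp
  also have "\<dots> = int q - 5"
    unfolding sum_common_nbrs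
    by (simp add: sum.distrib sum_qchar sum_qchar_diff sum_qchar_qchar_0)
  finally show ?thesis .
qed

lemma sum_common_nbrs_qchar:
  "4 * (\<Sum>x\<in>common_nbrs. qchar (x - y))
    = (if y = 0 then int q else 0) + (if y = 1 then int q else 0) - 2
      + legendre_sum y - 2 * qchar y - 2 * qchar (y - 1)"
proof -
  have "(\<Sum>x\<in>UNIV. (1 + qchar x + qchar (x - 1) + qchar x * qchar (x - 1)) * qchar (x - y))
     = (\<Sum>x\<in>UNIV. qchar (x - y)) + (\<Sum>x\<in>UNIV. qchar x * qchar (x - y))
      + (\<Sum>x\<in>UNIV. qchar (x - 1) * qchar (x - y)) + legendre_sum y"
    by (simp add: legendre_sum_def sum.distrib distrib_right)
  moreover have "qchar (1 - y) = qchar (y - 1)" by (rule qchar_diff_commute)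
  ultimately show ?thesis
    unfolding sum_common_nbrs sum_qchar_diff sum_qchar_qchar sum_qchar_qchar_0 by auto
qed

lemma double_sum_common_nbrs:
  "16 * (\<Sum>y\<in>common_nbrs. \<Sum>x\<in>common_nbrs. qchar (x - y)) = double_sum - 6 * int q + 36"
proof -
  define h where "h y = 1 + qchar y + qchar (y - 1) + qchar y * qchar (y - 1)" for y :: 'a
  define r where "r y = 4 * (\<Sum>x\<in>common_nbrs. qchar (x - y))" for y
  note r = r_def[unfolded sum_common_nbrs_qchar]
  have hl: "h y * legendre_sum y = legendre_sum y + qchar y * legendre_sum y
      + qchar (y - 1) * legendre_sum y + qchar y * qchar (y - 1) * legendre_sum y" for y
    by (simp add: h_def algebra_simps)
  have sum_hl: "(\<Sum>y\<in>UNIV. h y * legendre_sum y) = 2 + double_sum"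
    unfolding hl sum.distrib sum_legendre_sum sum_qchar_legendre_sum
      sum_qchar_shift_legendre_sum double_sum_def by simp
  have sum_h: "(\<Sum>y\<in>UNIV. h y) = int q - 1"
    by (simp add: h_def sum.distrib sum_qchar sum_qchar_diff sum_qchar_qchar_0)
  have sum_hq: "(\<Sum>y\<in>UNIV. h y * qchar y) = int q - 3"
  proof -
    \<comment> \<open>The bracket is \<open>qchar y * qchar y * qchar (y - 1)\<close>, which loses
      the value \<open>qchar (-1) = 1\<close> at \<open>y = 0\<close>.\<close>
    have "h y * qchar y = qchar y + qchar (y - 0) * qchar (y - 0) + qchar y * qchar (y - 1)
        + (qchar (y - 1) - (if y = 0 then 1 else 0))" for y
      by (simp add: h_def algebra_simps qchar_mult_self)
    thus ?thesis
      by (simp only: sum.distrib sum_subtractf sum_qchar sum_qchar_diff sum_qchar_qchar sum_qchar_qchar_0) simp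
  qed
  have sum_hq1: "(\<Sum>y\<in>UNIV. h y * qchar (y - 1)) = int q - 3"
  proof -
    have "h y * qchar (y - 1) = qchar (y - 1) + qchar (y - 1) * qchar (y - 1) + qchar y * qchar (y - 1)
        + (qchar y - (if y = 1 then 1 else 0))" for y
      by (simp add: h_def algebra_simps qchar_mult_self)
    thus ?thesis
      by (simp only: sum.distrib sum_subtractf sum_qchar sum_qchar_diff sum_qchar_qchar sum_qchar_qchar_0) simp
  qed
  have "16 * (\<Sum>y\<in>common_nbrs. \<Sum>x\<in>common_nbrs. qchar (x - y)) = 4 * (\<Sum>y\<in>common_nbrs. r y)"
    by (simp add: r_def sum_distrib_left)
  also have "\<dots> = (\<Sum>y\<in>UNIV. h y * r y) - 2 * r 0 - 2 * r 1"
    unfolding sum_common_nbrs h_def ..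
  also have "(\<Sum>y\<in>UNIV. h y * r y) = (\<Sum>y\<in>UNIV. h y * (if y = 0 then int q else 0)
      + h y * (if y = 1 then int q else 0) - 2 * h y + h y * legendre_sum y
      - 2 * (h y * qchar y) - 2 * (h y * qchar (y - 1)))"
    unfolding r by (intro sum.cong refl) (simp only: algebra_simps)
  also have "\<dots> = double_sum - 2 * int q + 16"
    unfolding sum.distrib sum_subtractf sum_distrib_left[symmetric] sum_if_eq sum_h sum_hq sum_hq1 sum_hl
    by (simp add: h_def)
  \<comment> \<open>\<open>r 0\<close> and \<open>r 1\<close> are both \<open>q - 5\<close>, four
    times the number of common neighbours, since all their summands are 1.\<close>
  finally show ?thesis
    by (simp add: r legendre_sum_0 legendre_sum_1)
qed

lemma card_common_nbr_edges:
  "32 * int (card common_nbr_edges) = (int q)\<^sup>2 - 20 * int q + 81 + double_sum"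
proof -
  have *: "common_nbr_edges = (SIGMA x:common_nbrs. {y \<in> common_nbrs. qchar (x - y) = 1})"
    by (auto simp: common_nbr_edges_def)
  have "card common_nbr_edges = (\<Sum>x\<in>common_nbrs. card {y \<in> common_nbrs. qchar (x - y) = 1})"
    unfolding * by (rule card_SigmaI) auto
  hence "2 * int (card common_nbr_edges) = (\<Sum>x\<in>common_nbrs. 2 * int (card {y \<in> common_nbrs. qchar (x - y) = 1}))"
    by (simp only: of_nat_sum sum_distrib_left)
  also have "\<dots> = (\<Sum>x\<in>common_nbrs. (\<Sum>y\<in>common_nbrs. 1 + qchar (x - y)) - 1)"
  proof (rule sum.cong)
    fix x assume x: "x \<in> common_nbrs"
    have "2 * int (card {y \<in> common_nbrs. qchar (x - y) = 1}) = (\<Sum>y\<in>common_nbrs. if qchar (x - y) = 1 then 2 else 0)"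
      by (simp add: sum.If_cases Int_def conj_commute)
    \<comment> \<open>On the diagonal \<open>1 + qchar 0\<close> is 1 although there is no loop;
      this is the subtracted term.\<close>
    also have "\<dots> = (\<Sum>y\<in>common_nbrs. (1 + qchar (x - y)) - (if y = x then 1 else 0))"
    proof (intro sum.cong refl)
      fix y
      show "(if qchar (x - y) = 1 then 2 else 0) = (1 + qchar (x - y)) - (if y = x then 1 else 0)"
        using qchar_cases[of "x - y"] by auto
    qed
    also have "\<dots> = (\<Sum>y\<in>common_nbrs. 1 + qchar (x - y)) - 1"
      using x by (simp only: sum_subtractf) simp
    finally show "2 * int (card {y \<in> common_nbrs. qchar (x - y) = 1}) = (\<Sum>y\<in>common_nbrs. 1 + qchar (x - y)) - 1" .
  qed simp
  also have "\<dots> = int (card common_nbrs) * int (card common_nbrs) - int (card common_nbrs)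
      + (\<Sum>x\<in>common_nbrs. \<Sum>y\<in>common_nbrs. qchar (x - y))"
    by (simp add: sum_subtractf sum.distrib)
  also have "(\<Sum>x\<in>common_nbrs. \<Sum>y\<in>common_nbrs. qchar (x - y)) = (\<Sum>y\<in>common_nbrs. \<Sum>x\<in>common_nbrs. qchar (x - y))"
    by (rule sum.swap)
  finally have "32 * int (card common_nbr_edges) = (4 * int (card common_nbrs)) * (4 * int (card common_nbrs))
      - 4 * (4 * int (card common_nbrs)) + 16 * (\<Sum>y\<in>common_nbrs. \<Sum>x\<in>common_nbrs. qchar (x - y))"
    by simp
  thus ?thesis
    unfolding card_common_nbrs double_sum_common_nbrs by (simp add: power2_eq_square algebra_simps)
qed

section \<open>Ordered cliques and affine maps\<close>

lemma paley_edges_iff: "(v, w) \<in> paley_edges \<longleftrightarrow> qchar (w - v) = 1"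
  by (simp only: paley_edges_def cayley_edges_def qchar_eq_1_iff mem_Collect_eq case_prod_conv)

text \<open>Symmetry halves the twelve adjacencies, and \<open>qchar 0 = 0\<close> forces distinct
  entries. The orientation \<open>c - d\<close> matches \<open>x - y\<close> in
  \<open>common_nbr_edges\<close>.\<close>

lemma ordered_4_cliques:
  "{xs. distinct xs \<and> set xs \<in> {C. clique (UNIV :: 'a set) paley_edges C \<and> finite C \<and> card C = 4}}
    = {[a, b, c, d] | a b c d. qchar (b - a) = 1 \<and> qchar (c - a) = 1 \<and> qchar (d - a) = 1
        \<and> qchar (c - b) = 1 \<and> qchar (d - b) = 1 \<and> qchar (c - d) = 1}" (is "?L = ?R")
proof (intro equalityI subsetI)
  fix xs assume xs: "xs \<in> ?L"
  hence "length xs = 4" using distinct_card[of xs] by simp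
  then obtain a b c d where "xs = [a, b, c, d]"
    by (auto simp: numeral_eq_Suc length_Suc_conv)
  thus "xs \<in> ?R" using xs by (auto simp: clique_def paley_edges_iff)
next
  fix xs assume "xs \<in> ?R"
  then obtain a b c d where xs: "xs = [a, b, c, d]"
    and 1: "qchar (b - a) = 1" "qchar (c - a) = 1" "qchar (d - a) = 1"
      "qchar (c - b) = 1" "qchar (d - b) = 1" "qchar (c - d) = 1" by auto
  have 2: "qchar (a - b) = 1" "qchar (a - c) = 1" "qchar (a - d) = 1"
      "qchar (b - c) = 1" "qchar (b - d) = 1" "qchar (d - c) = 1"
    using 1 qchar_diff_commute by metis+
  have distinct: "distinct xs" using 1 by (auto simp: xs)
  have "card (set xs) = 4" using distinct_card[OF distinct] by (simp add: xs)
  moreover have "clique UNIV paley_edges (set xs)"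
    by (simp add: clique_def paley_edges_iff xs 1 2)
  ultimately show "xs \<in> ?L" using distinct by simp
qed

text \<open>Affine maps with square slope are automorphisms, so every ordered 4-clique arises from
  exactly one of the form \<open>(0, 1, x, y)\<close>.\<close>

lemma paley_K4_eq_common_nbr_edges:
  "48 * int (paley_K4 TYPE('a)) = int q * (int q - 1) * int (card common_nbr_edges)"
proof -
  define K where "K = {C. clique (UNIV :: 'a set) paley_edges C \<and> finite C \<and> card C = 4}"
  define S where "S = {s :: 'a. qchar s = 1}"
  define R where "R = {[a, b, c, d] | a b c d :: 'a. qchar (b - a) = 1 \<and> qchar (c - a) = 1 \<and> qchar (d - a) = 1
        \<and> qchar (c - b) = 1 \<and> qchar (d - b) = 1 \<and> qchar (c - d) = 1}"
  define g where "g = (\<lambda>(v, s, x, y). [v, v + s, v + s * x, v + s * y :: 'a])"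
  define g' where "g' xs = (xs ! 0, xs ! 1 - xs ! 0, (xs ! 2 - xs ! 0) / (xs ! 1 - xs ! 0),
    (xs ! 3 - xs ! 0) / (xs ! 1 - xs ! 0))" for xs :: "'a list"
  have "bij_betw g ((UNIV :: 'a set) \<times> S \<times> common_nbr_edges) R"
  proof (rule bij_betw_byWitness[where f' = g'])
    show "\<forall>a\<in>(UNIV :: 'a set) \<times> S \<times> common_nbr_edges. g' (g a) = a"
      by (auto simp: g_def g'_def S_def)
    show "\<forall>xs\<in>R. g (g' xs) = xs"
    proof
      fix xs assume "xs \<in> R"
      then obtain a b c d where "xs = [a, b, c, d]" "qchar (b - a) = 1" by (auto simp: R_def)
      thus "g (g' xs) = xs"
        by (cases "b - a = 0") (simp_all add: g_def g'_def)
    qed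
    show "g ` ((UNIV :: 'a set) \<times> S \<times> common_nbr_edges) \<subseteq> R"
    proof (rule image_subsetI)
      fix z assume "z \<in> (UNIV :: 'a set) \<times> S \<times> common_nbr_edges"
      then obtain v s x y where z: "z = (v, s, x, y)" and s: "s \<in> S" and xy: "(x, y) \<in> common_nbr_edges"
        by auto
      have "v + s * x - (v + s) = s * (x - 1)" "v + s * y - (v + s) = s * (y - 1)"
        "v + s * x - (v + s * y) = s * (x - y)"
        by (simp_all add: algebra_simps)
      thus "g z \<in> R"
        using s xy by (auto simp: z g_def R_def S_def common_nbr_edges_def common_nbrs_def)
    qed
    show "g' ` R \<subseteq> (UNIV :: 'a set) \<times> S \<times> common_nbr_edges"
    proof (rule image_subsetI)
      fix xs assume "xs \<in> R"
      then obtain a b c d where xs: "xs = [a, b, c, d]" and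
        1: "qchar (b - a) = 1" "qchar (c - a) = 1" "qchar (d - a) = 1"
        "qchar (c - b) = 1" "qchar (d - b) = 1" "qchar (c - d) = 1" by (auto simp: R_def)
      have ba: "b - a \<noteq> 0" using 1(1) by (metis qchar_0 zero_neq_one)
      have "(c - a) / (b - a) - 1 = (c - b) / (b - a)" "(d - a) / (b - a) - 1 = (d - b) / (b - a)"
        "(c - a) / (b - a) - (d - a) / (b - a) = (c - d) / (b - a)"
        using ba by (simp_all add: diff_divide_distrib[symmetric] divide_diff_eq_iff)
      thus "g' xs \<in> (UNIV :: 'a set) \<times> S \<times> common_nbr_edges"
        by (simp add: xs g'_def S_def common_nbr_edges_def common_nbrs_def 1)
    qed
  qed
  hence "card R = q * card S * card common_nbr_edges"
    by (simp add: bij_betw_same_card[symmetric] card_cartesian_product)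
  moreover have "card S = q div 2"
    using card_nonzero_squares by (simp add: S_def qchar_eq_1_iff del: mem_Collect_eq)
  moreover have "card R = fact 4 * card K"
    unfolding R_def ordered_4_cliques[symmetric] K_def
    by (rule card_list_sets) auto
  moreover have "fact 4 = (24::nat)" by (simp add: fact_numeral)
  \<comment> \<open>48 is 24 orderings times 2, the latter because only half of the nonzero slopes
    are squares.\<close>
  ultimately have "48 * card K = q * (2 * (q div 2)) * card common_nbr_edges" by simp
  hence "48 * card K = q * (q - 1) * card common_nbr_edges" by (simp only: half_q)
  hence "int (48 * card K) = int (q * (q - 1) * card common_nbr_edges)" by (rule arg_cong)
  thus ?thesis
    using q_gt_1 by (simp add: paley_K4_def num_cliques_def K_def of_nat_diff)
qed

end

section \<open>The Jacobsthal sum modulo p\<close>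

text \<open>The coefficientwise form of \<open>(1 + X)^p = 1 + X^p\<close> modulo \<open>p\<close>:
  in Vandermonde's convolution only the terms \<open>j = 0\<close> and \<open>j = p\<close>
  survive.\<close>

lemma cong_choose_prime_add:
  fixes p n k :: nat
  assumes "prime p"
  shows "[(p + n) choose k = (n choose k) + (if p \<le> k then n choose (k - p) else 0)] (mod p)"
proof -
  let ?f = "\<lambda>j. (p choose j) * (n choose (k - j))"
  have p: "p > 0" using assms by (rule prime_gt_0_nat)
  have "[(\<Sum>j\<le>k. ?f j) = (\<Sum>j\<le>k. if j = 0 \<or> j = p then ?f j else 0)] (mod p)"
  proof (rule cong_sum)
    fix j
    show "[?f j = (if j = 0 \<or> j = p then ?f j else 0)] (mod p)"
    proof (cases "0 < j \<and> j < p")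
      case True
      hence "p dvd p choose j" using assms by (intro dvd_choose_prime) auto
      thus ?thesis using True by (simp add: cong_0_iff)
    next
      case False
      thus ?thesis by (cases "j = 0 \<or> j = p") (auto simp: binomial_eq_0)
    qed
  qed
  also have "(\<Sum>j\<le>k. if j = 0 \<or> j = p then ?f j else 0)
      = (\<Sum>j\<le>k. (if j = 0 then n choose k else 0) + (if j = p then n choose (k - p) else 0))"
    using p by (intro sum.cong) auto
  also have "\<dots> = (n choose k) + (if p \<le> k then n choose (k - p) else 0)"
    by (simp add: sum.distrib)
  finally show ?thesis by (simp only: vandermonde)
qed

text \<open>Adding \<open>p\<close> to the upper entry acts modulo \<open>p\<close> as Pascal's rule
  on the leading parts \<open>a\<close> and \<open>b\<close>.\<close>

lemma lucas_binomial_step: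
  fixes p a b r s :: nat
  assumes "prime p" "r < p" "s < p"
  shows "[(p * a + r) choose (p * b + s) = (a choose b) * (r choose s)] (mod p)"
proof (induction a arbitrary: b)
  case 0
  show ?case
  proof (cases b)
    case (Suc b')
    hence "r < p * b + s" using assms(2) by simp
    thus ?thesis using Suc by (simp add: binomial_eq_0)
  qed simp
next
  case (Suc a)
  have eq: "p * Suc a + r = p + (p * a + r)" by simp
  have "[(p * Suc a + r) choose (p * b + s) = ((p * a + r) choose (p * b + s))
      + (if p \<le> p * b + s then (p * a + r) choose (p * b + s - p) else 0)] (mod p)"
    unfolding eq using assms(1) by (rule cong_choose_prime_add)
  also have "[((p * a + r) choose (p * b + s))
      + (if p \<le> p * b + s then (p * a + r) choose (p * b + s - p) else 0)
      = (a choose b) * (r choose s) + (if b = 0 then 0 else (a choose (b - 1)) * (r choose s))] (mod p)"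
  proof (rule cong_add[OF Suc.IH])
    show "[(if p \<le> p * b + s then (p * a + r) choose (p * b + s - p) else 0)
      = (if b = 0 then 0 else (a choose (b - 1)) * (r choose s))] (mod p)"
    proof (cases b)
      case 0
      thus ?thesis using assms(3) by simp
    next
      case (Suc b')
      hence "p * b + s - p = p * b' + s" "p \<le> p * b + s" by simp_all
      thus ?thesis using Suc.IH[of b'] Suc by simp
    qed
  qed
  also have "(a choose b) * (r choose s) + (if b = 0 then 0 else (a choose (b - 1)) * (r choose s))
      = (Suc a choose b) * (r choose s)"
    by (cases b) (simp_all add: algebra_simps)
  finally show ?case .
qed

text \<open>In base \<open>p\<close> all \<open>l\<close> digits of the upper entry are
  \<open>2 * m\<close> and those of the lower entry are \<open>m\<close>, where
  \<open>p = 4 * m + 1\<close>. By Lucas only \<open>2 * m choose m\<close> matters, which divides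
  the factorial of a number below \<open>p\<close>.\<close>

lemma not_dvd_central_binomial:
  fixes p l :: nat
  assumes "prime p" "p mod 4 = 1"
  shows "\<not> p dvd ((p ^ l) div 2) choose ((p ^ l) div 4)"
proof (induction l)
  case 0
  show ?case using prime_gt_1_nat[OF assms(1)] by simp
next
  case (Suc l)
  have p: "p = 4 * (p div 4) + 1" using assms(2) by presburger
  have "p ^ l mod 4 = 1" using power_mod[of p 4 l] assms(2) by simp
  hence pl: "p ^ l = 4 * (p ^ l div 4) + 1" by presburger
  define m k where "m = p div 4" and "k = p ^ l div 4"
  have pm: "p = 4 * m + 1" and plk: "p ^ l = 4 * k + 1"
    using p pl by (simp_all add: m_def k_def)
  have "p ^ Suc l = 4 * (p * k + m) + 1"
    by (simp add: plk) (simp add: pm)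
  moreover have div: "(4 * n + 1) div 2 = 2 * n" "(4 * n + 1) div 4 = n" for n :: nat
    by presburger+
  ultimately have 1: "p ^ Suc l div 2 = p * (2 * k) + 2 * m" "p ^ Suc l div 4 = p * k + m"
    by (simp_all only: div) (simp add: algebra_simps)
  have 2: "p ^ l div 2 = 2 * k" "p ^ l div 4 = k" unfolding plk by (rule div)+
  have "[(p * (2 * k) + 2 * m) choose (p * k + m) = (2 * k choose k) * (2 * m choose m)] (mod p)"
    using assms(1) pm by (intro lucas_binomial_step) simp_all
  moreover have "\<not> p dvd 2 * k choose k" using Suc.IH unfolding 2 .
  moreover have "\<not> p dvd 2 * m choose m"
  proof
    assume "p dvd 2 * m choose m"
    moreover have "(2 * m choose m) * (fact m * fact (2 * m - m)) = fact (2 * m)"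
      using binomial_fact_lemma[of m "2 * m"] by (simp add: mult_ac)
    ultimately have "p dvd fact (2 * m)" by (metis dvd_mult2)
    hence "p \<le> 2 * m" using assms(1) by (simp add: prime_dvd_fact_iff)
    thus False using pm by simp
  qed
  ultimately show ?case
    unfolding 1 using assms(1) by (metis cong_dvd_iff prime_dvd_mult_iff)
qed

section \<open>Power sums and the residue of the Jacobsthal sum\<close>

context paley_field begin

text \<open>Some nonzero \<open>a\<close> has \<open>a ^ m\<close> different from 1, as there are
  too few roots of unity; scaling by it multiplies the sum by \<open>a ^ m\<close>.\<close>

lemma sum_powers_eq_0:
  assumes "0 < m" "m < q - 1"
  shows "(\<Sum>x\<in>UNIV. x ^ m) = (0::'a)"
proof -
  have "card {x::'a. x ^ m = 1} \<le> m" using assms(1) by (rule card_roots_of_unity_le)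
  also have "m < card (UNIV - {0::'a})" using assms(2) by (simp add: card_Diff_singleton)
  finally have "\<not> UNIV - {0::'a} \<subseteq> {x. x ^ m = 1}"
    by (meson card_mono finite linorder_not_less)
  then obtain a :: 'a where a: "a \<noteq> 0" "a ^ m \<noteq> 1" by blast
  have "(\<Sum>x\<in>UNIV. (a * x) ^ m) = (\<Sum>x\<in>UNIV. x ^ m)"
    using a(1) by (rule sum_UNIV_mult)
  hence "a ^ m * (\<Sum>x\<in>UNIV. x ^ m) = (\<Sum>x\<in>UNIV. x ^ m)"
    by (simp only: power_mult_distrib sum_distrib_left)
  hence "(a ^ m - 1) * (\<Sum>x\<in>UNIV. x ^ m) = 0"
    by (simp only: left_diff_distrib mult_1_left) simp
  thus ?thesis using a(2) by simp
qed

text \<open>The range holds a single multiple of \<open>q - 1\<close>. It covers the exponents of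
  the expanded cubic, which reach only \<open>3 * (q - 1) / 2\<close>.\<close>

lemma sum_powers:
  assumes "0 < m" "m < 2 * (q - 1)"
  shows "(\<Sum>x\<in>UNIV. x ^ m) = (if m = q - 1 then -1 else (0::'a))"
proof -
  have of_nat_q: "of_nat q = (0::'a)"
    using CHAR_dvd_CARD[where ?'a='a] by (simp add: of_nat_eq_0_iff_char_dvd)
  consider "m < q - 1" | "m = q - 1" | "m > q - 1" by linarith
  then show ?thesis
  proof cases
    case 1
    with assms(1) have "(\<Sum>x\<in>UNIV. x ^ m) = (0::'a)" by (rule sum_powers_eq_0)
    with 1 show ?thesis by (simp only: less_irrefl if_False split: if_split) blast
  next
    case 2
    have "(\<Sum>x\<in>UNIV. x ^ m) = (\<Sum>x\<in>UNIV-{0::'a}. 1 :: 'a)"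
    proof (rule sum.mono_neutral_cong_right)
      show "\<forall>x\<in>UNIV - (UNIV - {0::'a}). x ^ m = 0"
        using assms(1) by (simp only: Diff_Diff_Int) (simp add: zero_power)
      show "x ^ m = 1" if "x \<in> UNIV - {0::'a}" for x
        using that unfolding 2 by (intro fermat) blast
    qed simp_all
    also have "\<dots> = of_nat (q - 1)"
      by (simp add: card_Diff_singleton)
    also have "\<dots> = -1"
      using q_gt_1 of_nat_q by (simp only: of_nat_diff less_imp_le of_nat_1 diff_0)
    finally show ?thesis by (simp only: 2 if_True refl)
  next
    case 3
    define m' where "m' = m - (q - 1)"
    have m: "m = (q - 1) + m'" "0 < m'" "m' < q - 1"
      using 3 assms(2) unfolding m'_def by linarith+
    have "x ^ m = x ^ m'" for x :: 'a
    proof (cases "x = 0")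
      case True
      thus ?thesis using assms(1) m(2) by (simp only: zero_power)
    next
      case False
      thus ?thesis by (simp only: m(1) power_add fermat[OF False] mult_1_left)
    qed
    hence "(\<Sum>x\<in>UNIV. x ^ m) = (\<Sum>x\<in>UNIV. x ^ m' :: 'a)"
      by (rule sum.cong[OF refl])
    also have "\<dots> = 0" using m(2,3) by (rule sum_powers_eq_0)
    finally show ?thesis using 3 by (simp only: less_irrefl if_False split: if_split) blast
  qed
qed

text \<open>By Euler's criterion the sum is one of powers of \<open>x^3 - x\<close>. Power sums
  extract the coefficient of \<open>x ^ (q - 1)\<close>, and the exponent \<open>h + 2 * k\<close>
  hits \<open>q - 1\<close> exactly at \<open>k = q div 4\<close>.\<close>

lemma of_int_jacobsthal_sum:
  "of_int (jacobsthal_sum (-1)) = - ((-1) ^ (q div 4) * of_nat (q div 2 choose (q div 4)) :: 'a)"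
proof -
  define h where "h = q div 2"
  have h: "q - 1 = 2 * h" "h = 2 * (q div 4)" "h > 0"
    using card_mod_4 half_q(3) half_q(1) unfolding h_def by presburger+
  have "of_int (jacobsthal_sum (-1)) = (\<Sum>x\<in>UNIV. x ^ h * (x\<^sup>2 + (-1)) ^ h :: 'a)"
    by (simp only: jacobsthal_sum_def of_int_sum of_int_mult of_int_qchar h_def)
  also have "\<dots> = (\<Sum>x\<in>UNIV. \<Sum>k\<le>h. of_nat (h choose k) * (-1) ^ (h - k) * x ^ (h + 2 * k) :: 'a)"
  proof (intro sum.cong refl)
    fix x :: 'a
    have "x ^ (h + 2 * k) = x ^ h * (x\<^sup>2) ^ k" for k
      by (simp only: power_add power_mult)
    thus "x ^ h * (x\<^sup>2 + (-1)) ^ h = (\<Sum>k\<le>h. of_nat (h choose k) * (-1) ^ (h - k) * x ^ (h + 2 * k))"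
      unfolding binomial_ring sum_distrib_left by (intro sum.cong refl) (simp only: mult_ac)
  qed
  also have "\<dots> = (\<Sum>k\<le>h. \<Sum>x\<in>UNIV. of_nat (h choose k) * (-1) ^ (h - k) * x ^ (h + 2 * k) :: 'a)"
    by (rule sum.swap)
  also have "\<dots> = (\<Sum>k\<le>h. of_nat (h choose k) * (-1) ^ (h - k) * (if k = q div 4 then -1 else 0 :: 'a))"
  proof (intro sum.cong refl)
    fix k assume k: "k \<in> {..h}"
    have "(\<Sum>x\<in>UNIV. x ^ (h + 2 * k)) = (if h + 2 * k = q - 1 then -1 else (0::'a))"
      using k h by (intro sum_powers) simp_all
    moreover have "h + 2 * k = q - 1 \<longleftrightarrow> k = q div 4" using h(1,2) by linarith
    ultimately show "(\<Sum>x\<in>UNIV. of_nat (h choose k) * (-1) ^ (h - k) * x ^ (h + 2 * k) :: 'a)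
      = of_nat (h choose k) * (-1) ^ (h - k) * (if k = q div 4 then -1 else 0)"
      by (simp only: sum_distrib_left[symmetric])
  qed
  also have "\<dots> = (\<Sum>k\<le>h. if k = q div 4 then - (of_nat (h choose (q div 4)) * (-1) ^ (h - q div 4)) else 0 :: 'a)"
    by (intro sum.cong) auto
  also have "\<dots> = - (of_nat (h choose (q div 4)) * (-1) ^ (h - q div 4))"
  proof -
    have "q div 4 \<le> h" using h(2) by linarith
    thus ?thesis by (simp only: sum.delta finite_atMost atMost_iff if_True)
  qed
  also have "h - q div 4 = q div 4" using h(2) by linarith
  finally show ?thesis by (simp only: h_def mult.commute)
qed

lemma not_dvd_jacobsthal_sum:
  assumes "prime p" "p mod 4 = 1" "q = p ^ l"
  shows "\<not> int p dvd jacobsthal_sum (-1)"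
proof -
  have "prime CHAR('a)"
    by (rule prime_CHAR_semidom) (simp add: finite_imp_CHAR_pos)
  moreover have "CHAR('a) dvd p ^ l"
    using CHAR_dvd_CARD[where ?'a='a] assms(3) by simp
  ultimately have char: "CHAR('a) = p"
    using assms(1) by (meson prime_dvd_power primes_dvd_imp_eq)
  have "of_nat (q div 2 choose (q div 4)) \<noteq> (0::'a)"
    using not_dvd_central_binomial[OF assms(1,2)] unfolding assms(3)
    by (simp add: of_nat_eq_0_iff_char_dvd char)
  hence "of_int (jacobsthal_sum (-1)) \<noteq> (0::'a)"
    unfolding of_int_jacobsthal_sum by simp
  thus ?thesis by (simp add: of_int_eq_0_iff_char_dvd char)
qed

text \<open>Integrality decides the parity of \<open>e\<close>: for even \<open>e\<close> the
  expression for \<open>32 * M\<close> would leave remainder 12 modulo 16.\<close>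

theorem paley_K4_two_squares:
  assumes "prime p" "p mod 4 = 1" "q = p ^ l"
  obtains e f :: int where "int q = e\<^sup>2 + f\<^sup>2" "odd e" "\<not> int p dvd e"
    "1536 * int (paley_K4 TYPE('a)) = int q * (int q - 1) * ((int q - 9)\<^sup>2 - 4 * f\<^sup>2)"
proof -
  obtain n :: 'a where n: "qchar n = -1" by (rule exists_nonsquare)
  define E F where "E = jacobsthal_sum (-1)" and "F = jacobsthal_sum (-n)"
  have EF: "E\<^sup>2 + F\<^sup>2 = 4 * int q"
    using jacobsthal_two_squares[OF n] by (simp add: E_def F_def)
  have sq: "x\<^sup>2 mod 4 = (if even x then 0 else 1)" for x :: int
  proof -
    define b where "b = x div 2"
    have "x = 2 * b \<and> even x \<or> x = 2 * b + 1 \<and> odd x" unfolding b_def by presburger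
    hence "x\<^sup>2 = 4 * b\<^sup>2 \<and> even x \<or> x\<^sup>2 = 4 * (b\<^sup>2 + b) + 1 \<and> odd x"
      by (elim disjE conjE) (simp_all add: power2_eq_square algebra_simps)
    then obtain c where "x\<^sup>2 = 4 * c \<and> even x \<or> x\<^sup>2 = 4 * c + 1 \<and> odd x" by blast
    thus ?thesis by presburger
  qed
  \<comment> \<open>Squares are 0 or 1 modulo 4, so two squares with sum divisible by 4 are both
    even.\<close>
  have "(E\<^sup>2 mod 4 + F\<^sup>2 mod 4) mod 4 = 0" unfolding mod_add_eq EF by simp
  hence "even E \<and> even F"
    unfolding sq by (simp split: if_splits)
  then obtain e f where e: "E = 2 * e" and f: "F = 2 * f" by (auto elim!: evenE)
  have ef: "int q = e\<^sup>2 + f\<^sup>2" using EF by (simp add: e f power_mult_distrib)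
  define M where "M = int (card common_nbr_edges)"
  have M: "32 * M = (int q)\<^sup>2 - 22 * int q + 81 + 4 * e\<^sup>2"
    using card_common_nbr_edges jacobsthal_sum_squared
    by (simp add: M_def E_def[symmetric] e power_mult_distrib)
  have odd: "odd e"
  proof
    assume "even e"
    define k where "k = int q div 4"
    have "int q mod 4 = 1" using card_mod_4 by presburger
    hence "int q = 4 * k + 1" unfolding k_def by presburger
    hence "32 * M = 16 * k\<^sup>2 - 80 * k + 60 + 4 * e\<^sup>2"
      unfolding M by (simp add: power2_eq_square algebra_simps)
    moreover obtain c where "e\<^sup>2 = 4 * c" using \<open>even e\<close> by (auto elim!: evenE simp: power_mult_distrib)
    ultimately have "32 * M = 16 * (k\<^sup>2 - 5 * k + 3 + c) + 12" by simp
    thus False by presburger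
  qed
  have dvd: "\<not> int p dvd e"
    using not_dvd_jacobsthal_sum[OF assms] e by (auto simp: E_def)
  have K4: "1536 * int (paley_K4 TYPE('a)) = int q * (int q - 1) * ((int q - 9)\<^sup>2 - 4 * f\<^sup>2)"
  proof -
    have "32 * M = (int q - 9)\<^sup>2 - 4 * f\<^sup>2"
      unfolding M using ef by (simp add: power2_eq_square algebra_simps)
    moreover have "1536 * int (paley_K4 TYPE('a)) = int q * (int q - 1) * (32 * M)"
      using paley_K4_eq_common_nbr_edges by (simp add: M_def)
    ultimately show ?thesis by simp
  qed
  show ?thesis by (rule that[OF ef odd dvd K4])
qed

end

section \<open>Primitive representations as sums of two squares\<close>

text \<open>The induction carries the extra invariant that \<open>p\<close> divides
  \<open>2 * f * B + e * A\<close>, the real part of the power times the conjugate of the base. It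
  makes the next real part congruent to \<open>2 * e * A\<close>. At exponent 0 the invariant would
  read \<open>p dvd e\<close>, hence the start at \<open>Suc 0\<close>.\<close>

lemma gaussian_power_primitive:
  fixes e f :: int and p n :: nat
  assumes p: "int p = e\<^sup>2 + 4 * f\<^sup>2" and prime: "prime p" "odd p" and coprime: "coprime e (int p)"
  obtains A B :: int where
    "(of_int e + 2 * of_int f * \<i>) ^ Suc n = of_int A + of_int B * \<i>"
    "A\<^sup>2 + B\<^sup>2 = int p ^ Suc n" "odd A" "even B" "\<not> int p dvd A"
proof -
  have prime': "prime (int p)" using prime(1) by simp
  have "odd (int p)" using prime(2) by simp
  hence odd_e: "odd e" unfolding p by simp
  have not_dvd_e: "\<not> int p dvd e"
  proof
    assume "int p dvd e"
    hence "is_unit (int p)" using coprime by (metis coprime_common_divisor dvd_refl)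
    thus False using prime' by (metis not_prime_unit)
  qed
  have not_dvd_2: "\<not> int p dvd 2"
  proof
    assume "int p dvd 2"
    hence "int p = 2" using prime' two_is_prime by (metis primes_dvd_imp_eq)
    thus False using \<open>odd (int p)\<close> by simp
  qed
  have "\<exists>A B :: int. (of_int e + 2 * of_int f * \<i>) ^ Suc n = of_int A + of_int B * \<i> \<and>
    A\<^sup>2 + B\<^sup>2 = int p ^ Suc n \<and> odd A \<and> even B \<and> \<not> int p dvd A \<and> int p dvd 2 * f * B + e * A"
  proof (induction n)
    case 0
    have "int p dvd 2 * f * (2 * f) + e * e"
      unfolding p by (simp add: power2_eq_square algebra_simps)
    then show ?case
      using p odd_e not_dvd_e
      by (intro exI[of _ e] exI[of _ "2 * f"]) (simp add: power_mult_distrib)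
  next
    case (Suc n)
    then obtain A B :: int where
      AB: "(of_int e + 2 * of_int f * \<i>) ^ Suc n = of_int A + of_int B * \<i>"
      and norm: "A\<^sup>2 + B\<^sup>2 = int p ^ Suc n" and parity: "odd A" "even B"
      and A: "\<not> int p dvd A" and dvd: "int p dvd 2 * f * B + e * A" by blast
    define A' B' where "A' = e * A - 2 * f * B" and "B' = e * B + 2 * f * A"
    have "(of_int e + 2 * of_int f * \<i>) ^ Suc (Suc n) = of_int A' + of_int B' * \<i>"
      unfolding power_Suc[of _ "Suc n"] AB A'_def B'_def
      by (simp add: complex_eq_iff algebra_simps)
    moreover have "A'\<^sup>2 + B'\<^sup>2 = (e\<^sup>2 + 4 * f\<^sup>2) * (A\<^sup>2 + B\<^sup>2)"
      by (simp add: A'_def B'_def power2_eq_square algebra_simps)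
    hence "A'\<^sup>2 + B'\<^sup>2 = int p ^ Suc (Suc n)"
      unfolding norm p[symmetric] by simp
    moreover have "odd A'" "even B'"
      using odd_e parity by (simp_all add: A'_def B'_def)
    moreover have "\<not> int p dvd A'"
    proof
      assume "int p dvd A'"
      hence "int p dvd A' + (2 * f * B + e * A)" using dvd by (rule dvd_add)
      also have "A' + (2 * f * B + e * A) = 2 * (e * A)" by (simp add: A'_def)
      finally show False using A not_dvd_e not_dvd_2 prime' by (simp add: prime_dvd_mult_iff)
    qed
    moreover have "int p dvd 2 * f * B' + e * A'"
    proof -
      have "2 * f * B' + e * A' = int p * A"
        unfolding p A'_def B'_def by (simp add: power2_eq_square algebra_simps)
      thus ?thesis by simp
    qed
    ultimately show ?case by blast
  qed
  thus ?thesis using that by blast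
qed

text \<open>By the two-squares product identity, \<open>N^2 = (A * f - e * B)^2 + C^2\<close>. The
  parities make \<open>C\<close> odd, hence nonzero, so the other term is below \<open>N^2\<close>
  and a multiple of \<open>N\<close> can only be 0. The vectors are then proportional and of equal
  norm.\<close>

lemma two_squares_eq_if_dvd:
  fixes A B e f :: int
  assumes N: "N = A\<^sup>2 + B\<^sup>2" "N = e\<^sup>2 + f\<^sup>2" and odd: "odd A" "even B" "odd e" "even f"
    and dvd: "N dvd A * f - e * B"
  shows "B\<^sup>2 = f\<^sup>2"
proof -
  have A: "A \<noteq> 0" using odd(1) by auto
  have N_pos: "N > 0" unfolding N(1) using A by (simp add: add_pos_nonneg)
  obtain k where k: "A * f - e * B = N * k" using dvd by (rule dvdE)
  define C where "C = A * e + B * f"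
  have "odd C" using odd by (simp add: C_def)
  hence C: "C\<^sup>2 > 0" by auto
  have "N * N = (A * f - e * B)\<^sup>2 + C\<^sup>2"
    unfolding C_def by (subst (1) N(1), subst N(2)) (simp add: power2_eq_square algebra_simps)
  hence "N\<^sup>2 * 1 = N\<^sup>2 * k\<^sup>2 + C\<^sup>2"
    by (simp add: k power_mult_distrib power2_eq_square)
  hence "N\<^sup>2 * k\<^sup>2 < N\<^sup>2 * 1" using C by linarith
  hence "k\<^sup>2 < 1" using N_pos by (simp only: mult_less_cancel_left_pos zero_less_power)
  hence "k = 0" using zero_less_power2[of k] by linarith
  hence eq: "A * f = e * B" using k by simp
  have "N * B\<^sup>2 = (e * B)\<^sup>2 + f\<^sup>2 * B\<^sup>2"
    unfolding N(2) by (simp add: power2_eq_square algebra_simps)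
  also have "\<dots> = N * f\<^sup>2"
    unfolding N(1) eq[symmetric] by (simp add: power2_eq_square algebra_simps)
  finally show ?thesis using N_pos by simp
qed

text \<open>The number \<open>p\<^sup>l\<close> divides \<open>A\<^sup>2 f\<^sup>2 - e\<^sup>2 B\<^sup>2 = (A f - e B) (A f + e B)\<close>, but \<open>p\<close> cannot divide
  both factors.\<close>

lemma primitive_two_squares_unique:
  fixes A B e f :: int and p l :: nat
  assumes prime: "prime p" "odd p"
    and AB: "int p ^ l = A\<^sup>2 + B\<^sup>2" and ef: "int p ^ l = e\<^sup>2 + f\<^sup>2"
    and odd: "odd A" "even B" "odd e" "even f" and A: "\<not> int p dvd A" and e: "\<not> int p dvd e"
  shows "B\<^sup>2 = f\<^sup>2"
proof -
  have prime': "prime (int p)" using prime(1) by simp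
  have f2_B2: "f\<^sup>2 = int p ^ l - e\<^sup>2" "B\<^sup>2 = int p ^ l - A\<^sup>2" using AB ef by simp_all
  have "(A * f - e * B) * (A * f + e * B) = A\<^sup>2 * f\<^sup>2 - e\<^sup>2 * B\<^sup>2"
    by (simp add: power2_eq_square algebra_simps)
  also have "\<dots> = int p ^ l * (A\<^sup>2 - e\<^sup>2)"
    unfolding f2_B2 by (simp add: algebra_simps)
  finally have factors: "(A * f - e * B) * (A * f + e * B) = int p ^ l * (A\<^sup>2 - e\<^sup>2)" .
  consider "l = 0" | "\<not> int p dvd A * f - e * B" "l > 0" | "\<not> int p dvd A * f + e * B" "l > 0"
    | "int p dvd A * f - e * B" "int p dvd A * f + e * B" "l > 0" by blast
  then show ?thesis
  proof cases
    case 1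
    have "int p ^ l dvd A * f - e * B" using 1 by simp
    thus ?thesis by (rule two_squares_eq_if_dvd[OF AB ef odd])
  next
    case 2
    have "int p ^ l dvd (A * f + e * B) * (A * f - e * B)"
      unfolding mult.commute[of "A * f + e * B"] factors by simp
    moreover have "coprime (int p ^ l) (A * f - e * B)"
      using 2 prime' by (simp add: prime_imp_coprime)
    \<comment> \<open>Negating \<open>B\<close> exchanges the two factors.\<close>
    ultimately have "int p ^ l dvd A * f - e * (- B)"
      by (simp add: coprime_dvd_mult_left_iff)
    moreover have "int p ^ l = A\<^sup>2 + (- B)\<^sup>2" "even (- B)" using AB odd by simp_all
    ultimately have "(- B)\<^sup>2 = f\<^sup>2"
      using ef odd by (intro two_squares_eq_if_dvd[of "int p ^ l" A "-B" e f])
    thus ?thesis by simp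
  next
    case 3
    have "int p ^ l dvd (A * f - e * B) * (A * f + e * B)"
      unfolding factors by simp
    moreover have "coprime (int p ^ l) (A * f + e * B)"
      using 3 prime' by (simp add: prime_imp_coprime)
    ultimately have "int p ^ l dvd A * f - e * B"
      by (simp add: coprime_dvd_mult_left_iff)
    thus ?thesis by (rule two_squares_eq_if_dvd[OF AB ef odd])
  next
    case 4
    have not_dvd_2: "\<not> int p dvd 2"
    proof
      assume "int p dvd 2"
      hence "int p = 2" using prime' two_is_prime by (metis primes_dvd_imp_eq)
      thus False using prime(2) by presburger
    qed
    \<comment> \<open>The sum of the factors is \<open>2 * A * f\<close>, so \<open>p\<close>
      divides \<open>f\<close> and then also \<open>e\<close>, against primitivity.\<close>
    have "int p dvd (A * f - e * B) + (A * f + e * B)" using 4(1,2) by (rule dvd_add)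
    hence "int p dvd 2 * (A * f)" by simp
    hence "int p dvd f" using A not_dvd_2 prime' by (simp add: prime_dvd_mult_iff)
    moreover have "int p dvd e\<^sup>2 + f\<^sup>2" unfolding ef[symmetric] using 4(3) by simp
    ultimately have "int p dvd e\<^sup>2" by (simp add: dvd_add_left_iff power2_eq_square)
    with prime' have "int p dvd e" by (rule prime_dvd_power)
    thus ?thesis using e by simp
  qed
qed

section \<open>From two squares to the clique formula\<close>

lemma f_seq_eq_Im: "f_seq e f l = of_real (Im ((of_real e + 2 * of_real f * \<i>) ^ l) / 2)"
proof -
  define w where "w = (of_real e + 2 * of_real f * \<i>) ^ l"
  have "(of_real e - 2 * of_real f * \<i>) ^ l = cnj w" by (simp add: w_def)
  hence "f_seq e f l = - (\<i> / 4) * w + (\<i> / 4) * cnj w"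
    by (simp add: f_seq_def w_def)
  thus ?thesis unfolding w_def[symmetric] by (simp add: complex_eq_iff)
qed

text \<open>The Jacobsthal sums and the Gaussian power give two primitive representations of
  \<open>p ^ l\<close>, so their even parts agree up to sign. The signs of \<open>e\<close> and
  \<open>f\<close> stay free because the square roots in \<open>K4_from_prime_field\<close> return
  absolute values.\<close>

lemma paley_K4_formula:
  fixes p l :: nat and e f :: int
  assumes prime: "prime p" and p4: "p mod 4 = 1" and l: "l \<ge> 1"
    and card: "CARD('a::{field,finite}) = p ^ l"
    and p: "int p = e\<^sup>2 + 4 * f\<^sup>2" and coprime: "coprime e (int p)"
  shows "of_nat (paley_K4 TYPE('a)) = K4_formula p l (of_int e) (of_int f)"
proof -
  have "p ^ l mod 4 = 1" using power_mod[of p 4 l] p4 by simp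
  then interpret paley_field "TYPE('a)" "p ^ l" by unfold_locales (use card in simp_all)
  have odd_p: "odd p" using p4 by presburger
  obtain e' f' :: int where ef: "int (p ^ l) = e'\<^sup>2 + f'\<^sup>2" "odd e'" "\<not> int p dvd e'"
    and K4: "1536 * int (paley_K4 TYPE('a)) = int (p ^ l) * (int (p ^ l) - 1) * ((int (p ^ l) - 9)\<^sup>2 - 4 * f'\<^sup>2)"
    by (rule paley_K4_two_squares[OF prime p4 refl])
  have "odd (int (p ^ l))" using odd_p by simp
  hence even_f': "even f'" unfolding ef(1) using ef(2) by simp
  obtain A B :: int where AB: "(of_int e + 2 * of_int f * \<i>) ^ l = of_int A + of_int B * \<i>"
    "A\<^sup>2 + B\<^sup>2 = int p ^ l" "odd A" "even B" "\<not> int p dvd A"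
    using gaussian_power_primitive[OF p prime odd_p coprime, of "l - 1"] l by auto
  have "B\<^sup>2 = f'\<^sup>2"
    using primitive_two_squares_unique[OF prime odd_p AB(2)[symmetric] _ AB(3,4) ef(2) even_f' AB(5) ef(3)] ef(1)
    by simp
  moreover have f_seq: "f_seq (of_int e) (of_int f) l = of_int B / 2"
    by (simp add: f_seq_eq_Im AB(1))
  have "16 * (f_seq (of_int e) (of_int f) l)\<^sup>2 = of_int (4 * B\<^sup>2)"
    unfolding f_seq by (simp add: power_divide)
  ultimately have f_seq_sq: "16 * (f_seq (of_int e) (of_int f) l)\<^sup>2 = of_int (4 * f'\<^sup>2)"
    by simp
  have "of_int (1536 * int (paley_K4 TYPE('a)))
      = (of_int (int (p ^ l) * (int (p ^ l) - 1) * ((int (p ^ l) - 9)\<^sup>2 - 4 * f'\<^sup>2)) :: complex)"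
    unfolding K4 ..
  thus ?thesis
    unfolding K4_formula_def f_seq_sq by (simp add: eq_divide_eq mult.commute)
qed

theorem theorem4p3:
  fixes p l :: nat
  assumes "prime p" and "[p = 1] (mod 4)" and "l \<ge> 1"
    and "CARD('b::{field,finite}) = p"
    and "CARD('a::{field,finite}) = p ^ l"
  shows "of_nat (paley_K4 TYPE('a)) = K4_from_prime_field p l (paley_K4 TYPE('b)) \<and>
    (\<exists>e1 f1 :: int. int p = e1\<^sup>2 + 4 * f1\<^sup>2 \<and> [e1 = 1] (mod 4) \<and> coprime e1 (int p)) \<and>
    (\<forall>e1 f1 :: int. int p = e1\<^sup>2 + 4 * f1\<^sup>2 \<and> [e1 = 1] (mod 4) \<and> coprime e1 (int p) \<longrightarrow>
       f_seq (of_int e1) (of_int f1) l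
         = of_real (Im ((of_int e1 + 2 * of_int f1 * \<i>) ^ l) / 2) \<and>
       of_nat (paley_K4 TYPE('a)) =
         of_nat p ^ l * (of_nat p ^ l - 1)
           * ((of_nat p ^ l - 9)\<^sup>2 - 16 * (f_seq (of_int e1) (of_int f1) l)\<^sup>2) / (2 ^ 9 * 3))"
proof -
  have p4: "p mod 4 = 1" using assms(2) by (simp add: cong_def)
  interpret paley_field "TYPE('b)" p by unfold_locales (use assms(4) p4 in simp_all)
  obtain e f' :: int where ef': "int p = e\<^sup>2 + f'\<^sup>2" "odd e" "\<not> int p dvd e"
    and K4: "1536 * int (paley_K4 TYPE('b)) = int p * (int p - 1) * ((int p - 9)\<^sup>2 - 4 * f'\<^sup>2)"
    \<comment> \<open>Taken with exponent 1, the theorem over the prime field supplies both a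
      representation of \<open>p\<close> and the link from its clique count to
      \<open>f\<close>.\<close>
    by (rule paley_K4_two_squares[OF assms(1) p4 power_one_right[symmetric]])
  have "odd (int p)" using p4 by presburger
  hence "even f'" unfolding ef'(1) using ef'(2) by simp
  then obtain f where f: "f' = 2 * f" by (rule evenE)
  have ef: "int p = e\<^sup>2 + 4 * f\<^sup>2" using ef'(1) by (simp add: f power_mult_distrib)
  have coprime: "coprime e (int p)"
    using ef'(3) assms(1) prime_imp_coprime[of "int p" e] by (simp add: coprime_commute)
  have "of_nat (paley_K4 TYPE('a)) = K4_formula p l (of_int \<bar>e\<bar>) (of_int \<bar>f\<bar>)"
    using ef coprime by (intro paley_K4_formula[OF assms(1) p4 assms(3,5)]) simp_all
  also have "K4_formula p l (of_int \<bar>e\<bar>) (of_int \<bar>f\<bar>) = K4_from_prime_field p l (paley_K4 TYPE('b))"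
  proof -
    have "p > 1" using assms(1) by (rule prime_gt_1_nat)
    hence nz: "real p * (real p - 1) \<noteq> 0" by simp
    have "real_of_int (1536 * int (paley_K4 TYPE('b))) = of_int (int p * (int p - 1) * ((int p - 9)\<^sup>2 - 16 * f\<^sup>2))"
      unfolding K4 f by (simp add: power_mult_distrib)
    hence "1536 * real (paley_K4 TYPE('b)) = (real p * (real p - 1)) * ((real p - 9)\<^sup>2 - 16 * (of_int f)\<^sup>2)"
      by simp
    hence "1536 * real (paley_K4 TYPE('b)) / (real p * (real p - 1)) = (real p - 9)\<^sup>2 - 16 * (of_int f)\<^sup>2"
      using nz by (simp only: nonzero_mult_div_cancel_left[OF nz])
    hence F: "sqrt (((real p - 9)\<^sup>2 - 2 ^ 9 * 3 * real (paley_K4 TYPE('b)) / (real p * (real p - 1))) / 16) = of_int \<bar>f\<bar>"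
      by simp
    have "real_of_int (int p) = of_int (e\<^sup>2 + 4 * f\<^sup>2)" unfolding ef ..
    hence "sqrt (real p - 4 * (of_int \<bar>f\<bar>)\<^sup>2) = of_int \<bar>e\<bar>" by simp
    thus ?thesis unfolding K4_from_prime_field_def Let_def F by simp
  qed
  finally have K4_a: "of_nat (paley_K4 TYPE('a)) = K4_from_prime_field p l (paley_K4 TYPE('b))" .
  have ex: "\<exists>e1 f1 :: int. int p = e1\<^sup>2 + 4 * f1\<^sup>2 \<and> [e1 = 1] (mod 4) \<and> coprime e1 (int p)"
  proof -
    \<comment> \<open>An odd number or its negative is 1 modulo 4, so the normalisation is a choice
      of sign.\<close>
    have "e mod 4 = 1 \<or> (- e) mod 4 = 1" using ef'(2) by presburger
    hence "[e = 1] (mod 4) \<or> [- e = 1] (mod 4)" by (simp add: cong_def)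
    thus ?thesis
    proof
      assume "[e = 1] (mod 4)"
      thus ?thesis using ef coprime by blast
    next
      assume "[- e = 1] (mod 4)"
      moreover have "int p = (- e)\<^sup>2 + 4 * f\<^sup>2" "coprime (- e) (int p)" using ef coprime by simp_all
      ultimately show ?thesis by blast
    qed
  qed
  have all: "f_seq (of_int e1) (of_int f1) l = of_real (Im ((of_int e1 + 2 * of_int f1 * \<i>) ^ l) / 2)"
    "of_nat (paley_K4 TYPE('a)) = of_nat p ^ l * (of_nat p ^ l - 1)
       * ((of_nat p ^ l - 9)\<^sup>2 - 16 * (f_seq (of_int e1) (of_int f1) l)\<^sup>2) / (2 ^ 9 * 3)"
    if "int p = e1\<^sup>2 + 4 * f1\<^sup>2" "coprime e1 (int p)" for e1 f1 :: int
  proof -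
    show "f_seq (of_int e1) (of_int f1) l = of_real (Im ((of_int e1 + 2 * of_int f1 * \<i>) ^ l) / 2)"
      unfolding f_seq_eq_Im by simp
  next
    show "of_nat (paley_K4 TYPE('a)) = of_nat p ^ l * (of_nat p ^ l - 1)
       * ((of_nat p ^ l - 9)\<^sup>2 - 16 * (f_seq (of_int e1) (of_int f1) l)\<^sup>2) / (2 ^ 9 * 3)"
      unfolding K4_formula_def[symmetric] by (rule paley_K4_formula[OF assms(1) p4 assms(3,5) that])
  qed
  show ?thesis
    by (intro conjI allI impI K4_a ex all) (elim conjE, assumption)+
qed

end
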